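(* Let $\mathbb{A}$ be a cellular algebra over a field $\mathbb{F}$ with a decomposition $1_{\mathbb{A}}=\sum_{i\in I}e_i$ satisfying (A1)–(A4), and suppose $\Lambda=\Lambda^0$. Two elements $\lambda,\mu\in\Lambda$ lie in the same block of $\mathbb{A}$ if and only if there exist $\nu_0,\dots,\nu_r\in\Lambda$ such that: $\lambda$ and $\nu_0$ lie in the same cell-block of $e_i\mathbb{A}e_i$ for some $i\in I$; for each $j=0,\dots,r-1$, $\nu_j$ and $\nu_{j+1}$ lie in the same cell-block of $e_{i}\mathbb{A}e_{i}$ for some $i\in I$ (depending on $j$); and $\mu$ and $\nu_r$ lie in the same cell-block of $e_i\mathbb{A}e_i$ for some $i\in I$.
   Context: A cellular algebra over a field $\mathbb{F}$ is an associative unital $\mathbb{F}$-algebra $\mathbb{A}$ with a tuple $(\Lambda,T(\cdot),\mathsf{C},* )$ such that: $\Lambda$ is a finite poset; for each $\lambda\in\Lambda$, $T(\lambda)$ is a nonempty finite set and for $s,t\in T(\lambda)$ there is $c^\lambda_{st}\in\mathbb{A}$, with $\mathsf{C}=\{c^\lambda_{st}\}$ an $\mathbb{F}$-basis of $\mathbb{A}$; $*$ is an $\mathbb{F}$-linear anti-automorphism with $*^2=\mathrm{id}$ and $(c^\lambda_{st})^*=c^\lambda_{ts}$; and for $a\in\mathbb{A}$, $a c^\lambda_{st}\equiv\sum_{u\in T(\lambda)}r_a^{(u,s)}c^\lambda_{ut}\mod \mathbb{A}^{>\lambda}$ with $r_a^{(u,s)}\in\mathbb{F}$ depending only on $a,u,s$,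 where $\mathbb{A}^{>\lambda}$ is the span of basis elements $c^\mu_{xy}$ with $\mu>\lambda$. The cell module $\Delta(\lambda)$ has basis $\{c^\lambda_s\}$ and action $a c^\lambda_s=\sum_u r_a^{(u,s)}c^\lambda_u$, bilinear form $\langle c^\lambda_s,c^\lambda_t\rangle c^\lambda_{ub}\equiv c^\lambda_{us}c^\lambda_{tb}\mod\mathbb{A}^{>\lambda}$, radical $\operatorname{Rad}\Delta(\lambda)$; $\Lambda^0=\{\lambda\mid\langle\,,\rangle\ne0\}$ and $L(\lambda)=\Delta(\lambda)/\operatorname{Rad}\Delta(\lambda)$ for $\lambda\in\Lambda^0$ are the simple modules. For $\lambda\in\Lambda,\mu\in\Lambda^0$, $d_{\lambda\mu}=[\Delta(\lambda):L(\mu)]$; $\lambda,\mu$ are cell-linked if $d_{\lambda\mu}\neq0$, and a cell-block is an equivalence class of the equivalence relation on $\Lambda$ generated by cell-linkage. Blocks of $\mathbb{A}$ are labelled by the subsets of $\Lambda^0$ indexing simple modules in the same block. Assumptions: (A1) $I$ finite; (A2) $1_{\mathbb{A}}=\sum_{i\in I}e_i$, $e_i\neq0$, $e_i^2=e_i$, $e_ie_j=0$ for $i\neq j$; (A3) for each $\lambda$ and $t\in T(\lambda)$ there is $i$ with $e_ic^\lambda_{ts}=c^\lambda_{ts}$ for all $s$; (A4) $e_i^*=e_i$. Notation: $T(\lambda,i)=\{t\in T(\lambda)\mid e_ic^\lambda_{ts}=c^\lambda_{ts}\ \forall s\}$, $\Lambda_i=\{\lambda\mid T(\lambda,i)\neq\emptyset\}$.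 $e_i\mathbb{A}e_i$ is a cellular algebra with basis $\{c^\lambda_{st}\mid s,t\in T(\lambda,i),\lambda\in\Lambda_i\}$, poset $\Lambda_i$, and cell modules $V(\lambda,i)=e_i\Delta(\lambda)$; its cell-blocks are subsets of $\Lambda_i$. *)

theory Defs
  imports Complex_Main
begin

text \<open>
  Conventions.  The algebra is a type 'a of class ring_1 (ring with unit) which is
  a vector space over the field 'k via sc, with bilinear multiplication.
  A cellular datum is given by
    Lam :: 'l set (the poset, with order le),
    T   :: 'l => 't set,
    c   :: 'l => 't => 't => 'a  (c l s t is the basis element c^l_{st}).
  All notions below (A^{>l}, structure constants of the cell modules, the bilinear
  form, radical, simple modules, decomposition numbers, cell-linkage, cell-blocks)
  are defined relative to an arbitrary cellular datum, so that they can be applied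
  both to A itself and to the cellular subalgebras e_i A e_i (which use the same
  basis elements, the subposet Lam_i and the index sets T(l,i)).
  The cell module Delta(l) is realised as the space of coefficient vectors
  't => 'k supported on T l (the vector v corresponds to sum_s v s c^l_s).
  The parameter B is the carrier of the algebra acting (UNIV for A, e_i A e_i
  for the corner algebra); it is used to define submodules and homomorphisms.
\<close>

definition above ::
  "('k::field \<Rightarrow> 'a::ring_1 \<Rightarrow> 'a) \<Rightarrow> 'l set \<Rightarrow> ('l \<Rightarrow> 'l \<Rightarrow> bool) \<Rightarrow> ('l \<Rightarrow> 't set)
    \<Rightarrow> ('l \<Rightarrow> 't \<Rightarrow> 't \<Rightarrow> 'a) \<Rightarrow> 'l \<Rightarrow> 'a set" where
  "above sc Lam le T c l =
     module.span sc {c m x y | m x y. m \<in> Lam \<and> le l m \<and> m \<noteq> l \<and> x \<in> T m \<and> y \<in> T m}"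

definition cellular_algebra ::
  "('k::field \<Rightarrow> 'a::ring_1 \<Rightarrow> 'a) \<Rightarrow> 'l set \<Rightarrow> ('l \<Rightarrow> 'l \<Rightarrow> bool) \<Rightarrow> ('l \<Rightarrow> 't set)
    \<Rightarrow> ('l \<Rightarrow> 't \<Rightarrow> 't \<Rightarrow> 'a) \<Rightarrow> ('a \<Rightarrow> 'a) \<Rightarrow> bool" where
  "cellular_algebra sc Lam le T c star \<longleftrightarrow>
     \<comment> \<open>associative unital F-algebra\<close>
     vector_space sc \<and>
     (\<forall>k x y. sc k (x * y) = sc k x * y) \<and>
     (\<forall>k x y. sc k (x * y) = x * sc k y) \<and>
     \<comment> \<open>finite poset\<close>
     finite Lam \<and>
     (\<forall>l\<in>Lam. le l l) \<and>
     (\<forall>l\<in>Lam. \<forall>m\<in>Lam. le l m \<and> le m l \<longrightarrow> l = m) \<and>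
     (\<forall>l\<in>Lam. \<forall>m\<in>Lam. \<forall>n\<in>Lam. le l m \<and> le m n \<longrightarrow> le l n) \<and>
     \<comment> \<open>nonempty finite index sets\<close>
     (\<forall>l\<in>Lam. finite (T l) \<and> T l \<noteq> {}) \<and>
     \<comment> \<open>the c^l_{st} form a basis (pairwise distinct, independent, spanning)\<close>
     inj_on (\<lambda>(l, s, t). c l s t) {(l, s, t). l \<in> Lam \<and> s \<in> T l \<and> t \<in> T l} \<and>
     \<not> module.dependent sc {c l s t | l s t. l \<in> Lam \<and> s \<in> T l \<and> t \<in> T l} \<and>
     module.span sc {c l s t | l s t. l \<in> Lam \<and> s \<in> T l \<and> t \<in> T l} = UNIV \<and>
     \<comment> \<open>the anti-involution\<close>
     Vector_Spaces.linear sc sc star \<and>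
     (\<forall>x y. star (x * y) = star y * star x) \<and>
     (\<forall>x. star (star x) = x) \<and>
     (\<forall>l\<in>Lam. \<forall>s\<in>T l. \<forall>t\<in>T l. star (c l s t) = c l t s) \<and>
     \<comment> \<open>the cellular multiplication rule\<close>
     (\<forall>a. \<forall>l\<in>Lam. \<forall>s\<in>T l. \<exists>r :: 't \<Rightarrow> 'k. \<forall>t\<in>T l.
        a * c l s t - (\<Sum>u\<in>T l. sc (r u) (c l u t)) \<in> above sc Lam le T c l)"

definition cell_coeff ::
  "('k::field \<Rightarrow> 'a::ring_1 \<Rightarrow> 'a) \<Rightarrow> 'l set \<Rightarrow> ('l \<Rightarrow> 'l \<Rightarrow> bool) \<Rightarrow> ('l \<Rightarrow> 't set)
    \<Rightarrow> ('l \<Rightarrow> 't \<Rightarrow> 't \<Rightarrow> 'a) \<Rightarrow> 'a \<Rightarrow> 'l \<Rightarrow> 't \<Rightarrow> 't \<Rightarrow> 'k" where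
  "cell_coeff sc Lam le T c a l u s =
     (SOME r :: 't \<Rightarrow> 'k. \<forall>t\<in>T l.
        a * c l s t - (\<Sum>w\<in>T l. sc (r w) (c l w t)) \<in> above sc Lam le T c l) u"

definition cell_mod :: "('l \<Rightarrow> 't set) \<Rightarrow> 'l \<Rightarrow> ('t \<Rightarrow> 'k::field) set" where
  "cell_mod T l = {v. \<forall>x. x \<notin> T l \<longrightarrow> v x = 0}"

definition cell_act ::
  "('k::field \<Rightarrow> 'a::ring_1 \<Rightarrow> 'a) \<Rightarrow> 'l set \<Rightarrow> ('l \<Rightarrow> 'l \<Rightarrow> bool) \<Rightarrow> ('l \<Rightarrow> 't set)
    \<Rightarrow> ('l \<Rightarrow> 't \<Rightarrow> 't \<Rightarrow> 'a) \<Rightarrow> 'a \<Rightarrow> 'l \<Rightarrow> ('t \<Rightarrow> 'k) \<Rightarrow> ('t \<Rightarrow> 'k)" where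
  "cell_act sc Lam le T c a l v =
     (\<lambda>u. if u \<in> T l then (\<Sum>s\<in>T l. cell_coeff sc Lam le T c a l u s * v s) else 0)"

definition form_coeff ::
  "('k::field \<Rightarrow> 'a::ring_1 \<Rightarrow> 'a) \<Rightarrow> 'l set \<Rightarrow> ('l \<Rightarrow> 'l \<Rightarrow> bool) \<Rightarrow> ('l \<Rightarrow> 't set)
    \<Rightarrow> ('l \<Rightarrow> 't \<Rightarrow> 't \<Rightarrow> 'a) \<Rightarrow> 'l \<Rightarrow> 't \<Rightarrow> 't \<Rightarrow> 'k" where
  "form_coeff sc Lam le T c l s t =
     (SOME phi :: 'k. \<forall>u\<in>T l. \<forall>b\<in>T l.
        c l u s * c l t b - sc phi (c l u b) \<in> above sc Lam le T c l)"

definition cell_form ::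
  "('k::field \<Rightarrow> 'a::ring_1 \<Rightarrow> 'a) \<Rightarrow> 'l set \<Rightarrow> ('l \<Rightarrow> 'l \<Rightarrow> bool) \<Rightarrow> ('l \<Rightarrow> 't set)
    \<Rightarrow> ('l \<Rightarrow> 't \<Rightarrow> 't \<Rightarrow> 'a) \<Rightarrow> 'l \<Rightarrow> ('t \<Rightarrow> 'k) \<Rightarrow> ('t \<Rightarrow> 'k) \<Rightarrow> 'k" where
  "cell_form sc Lam le T c l v w =
     (\<Sum>s\<in>T l. \<Sum>t\<in>T l. v s * w t * form_coeff sc Lam le T c l s t)"

definition cell_rad ::
  "('k::field \<Rightarrow> 'a::ring_1 \<Rightarrow> 'a) \<Rightarrow> 'l set \<Rightarrow> ('l \<Rightarrow> 'l \<Rightarrow> bool) \<Rightarrow> ('l \<Rightarrow> 't set)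
    \<Rightarrow> ('l \<Rightarrow> 't \<Rightarrow> 't \<Rightarrow> 'a) \<Rightarrow> 'l \<Rightarrow> ('t \<Rightarrow> 'k) set" where
  "cell_rad sc Lam le T c l =
     {v \<in> cell_mod T l. \<forall>w\<in>cell_mod T l. cell_form sc Lam le T c l v w = 0}"

definition Lam0 ::
  "('k::field \<Rightarrow> 'a::ring_1 \<Rightarrow> 'a) \<Rightarrow> 'l set \<Rightarrow> ('l \<Rightarrow> 'l \<Rightarrow> bool) \<Rightarrow> ('l \<Rightarrow> 't set)
    \<Rightarrow> ('l \<Rightarrow> 't \<Rightarrow> 't \<Rightarrow> 'a) \<Rightarrow> 'l set" where
  "Lam0 sc Lam le T c =
     {l \<in> Lam. \<exists>s\<in>T l. \<exists>t\<in>T l. form_coeff sc Lam le T c l s t \<noteq> 0}"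

definition is_submod ::
  "('k::field \<Rightarrow> 'a::ring_1 \<Rightarrow> 'a) \<Rightarrow> 'l set \<Rightarrow> ('l \<Rightarrow> 'l \<Rightarrow> bool) \<Rightarrow> ('l \<Rightarrow> 't set)
    \<Rightarrow> ('l \<Rightarrow> 't \<Rightarrow> 't \<Rightarrow> 'a) \<Rightarrow> 'a set \<Rightarrow> 'l \<Rightarrow> ('t \<Rightarrow> 'k) set \<Rightarrow> bool" where
  "is_submod sc Lam le T c B l M \<longleftrightarrow>
     M \<subseteq> cell_mod T l \<and> (\<lambda>_. 0) \<in> M \<and>
     (\<forall>x\<in>M. \<forall>y\<in>M. (\<lambda>u. x u + y u) \<in> M) \<and>
     (\<forall>k. \<forall>x\<in>M. (\<lambda>u. k * x u) \<in> M) \<and>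
     (\<forall>a\<in>B. \<forall>x\<in>M. cell_act sc Lam le T c a l x \<in> M)"

text \<open>Isomorphism of subquotients M1/N1 (of Delta(l1)) and M2/N2 (of Delta(l2)):
  a linear map f with f(M1) in M2, inducing a bijective module map M1/N1 -> M2/N2.\<close>
definition subquot_iso ::
  "('k::field \<Rightarrow> 'a::ring_1 \<Rightarrow> 'a) \<Rightarrow> 'l set \<Rightarrow> ('l \<Rightarrow> 'l \<Rightarrow> bool) \<Rightarrow> ('l \<Rightarrow> 't set)
    \<Rightarrow> ('l \<Rightarrow> 't \<Rightarrow> 't \<Rightarrow> 'a) \<Rightarrow> 'a set
    \<Rightarrow> 'l \<Rightarrow> ('t \<Rightarrow> 'k) set \<Rightarrow> ('t \<Rightarrow> 'k) set
    \<Rightarrow> 'l \<Rightarrow> ('t \<Rightarrow> 'k) set \<Rightarrow> ('t \<Rightarrow> 'k) set \<Rightarrow> bool" where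
  "subquot_iso sc Lam le T c B l1 N1 M1 l2 N2 M2 \<longleftrightarrow>
     (\<exists>f :: ('t \<Rightarrow> 'k) \<Rightarrow> ('t \<Rightarrow> 'k).
        (\<forall>x y. f (\<lambda>u. x u + y u) = (\<lambda>u. f x u + f y u)) \<and>
        (\<forall>k x. f (\<lambda>u. k * x u) = (\<lambda>u. k * f x u)) \<and>
        f ` M1 \<subseteq> M2 \<and>
        {x \<in> M1. f x \<in> N2} = N1 \<and>
        (\<forall>y\<in>M2. \<exists>x\<in>M1. (\<lambda>u. y u - f x u) \<in> N2) \<and>
        (\<forall>a\<in>B. \<forall>x\<in>M1.
           (\<lambda>u. f (cell_act sc Lam le T c a l1 x) u - cell_act sc Lam le T c a l2 (f x) u) \<in> N2))"

definition comp_series ::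
  "('k::field \<Rightarrow> 'a::ring_1 \<Rightarrow> 'a) \<Rightarrow> 'l set \<Rightarrow> ('l \<Rightarrow> 'l \<Rightarrow> bool) \<Rightarrow> ('l \<Rightarrow> 't set)
    \<Rightarrow> ('l \<Rightarrow> 't \<Rightarrow> 't \<Rightarrow> 'a) \<Rightarrow> 'a set \<Rightarrow> 'l \<Rightarrow> ('t \<Rightarrow> 'k) set list \<Rightarrow> bool" where
  "comp_series sc Lam le T c B l Ms \<longleftrightarrow>
     Ms \<noteq> [] \<and> hd Ms = {\<lambda>_. 0} \<and> last Ms = cell_mod T l \<and>
     (\<forall>k<length Ms. is_submod sc Lam le T c B l (Ms ! k)) \<and>
     (\<forall>k. Suc k < length Ms \<longrightarrow>
        Ms ! k \<subset> Ms ! Suc k \<and>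
        \<not> (\<exists>N. is_submod sc Lam le T c B l N \<and> Ms ! k \<subset> N \<and> N \<subset> Ms ! Suc k))"

text \<open>Decomposition number d_{l m} = [Delta(l) : L(m)], L(m) = Delta(m)/Rad Delta(m),
  computed from a composition series (well defined by Jordan--Hoelder).\<close>
definition decomp_num ::
  "('k::field \<Rightarrow> 'a::ring_1 \<Rightarrow> 'a) \<Rightarrow> 'l set \<Rightarrow> ('l \<Rightarrow> 'l \<Rightarrow> bool) \<Rightarrow> ('l \<Rightarrow> 't set)
    \<Rightarrow> ('l \<Rightarrow> 't \<Rightarrow> 't \<Rightarrow> 'a) \<Rightarrow> 'a set \<Rightarrow> 'l \<Rightarrow> 'l \<Rightarrow> nat" where
  "decomp_num sc Lam le T c B l m =
     (let Ms = (SOME Ms. comp_series sc Lam le T c B l Ms) in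
       card {k. Suc k < length Ms \<and>
         subquot_iso sc Lam le T c B l (Ms ! k) (Ms ! Suc k)
                                     m (cell_rad sc Lam le T c m) (cell_mod T m)})"

definition cell_linked ::
  "('k::field \<Rightarrow> 'a::ring_1 \<Rightarrow> 'a) \<Rightarrow> 'l set \<Rightarrow> ('l \<Rightarrow> 'l \<Rightarrow> bool) \<Rightarrow> ('l \<Rightarrow> 't set)
    \<Rightarrow> ('l \<Rightarrow> 't \<Rightarrow> 't \<Rightarrow> 'a) \<Rightarrow> 'a set \<Rightarrow> 'l \<Rightarrow> 'l \<Rightarrow> bool" where
  "cell_linked sc Lam le T c B l m \<longleftrightarrow>
     l \<in> Lam \<and> m \<in> Lam0 sc Lam le T c \<and> decomp_num sc Lam le T c B l m \<noteq> 0"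

definition same_cell_block ::
  "('k::field \<Rightarrow> 'a::ring_1 \<Rightarrow> 'a) \<Rightarrow> 'l set \<Rightarrow> ('l \<Rightarrow> 'l \<Rightarrow> bool) \<Rightarrow> ('l \<Rightarrow> 't set)
    \<Rightarrow> ('l \<Rightarrow> 't \<Rightarrow> 't \<Rightarrow> 'a) \<Rightarrow> 'a set \<Rightarrow> 'l \<Rightarrow> 'l \<Rightarrow> bool" where
  "same_cell_block sc Lam le T c B l m \<longleftrightarrow>
     l \<in> Lam \<and> m \<in> Lam \<and>
     (l, m) \<in> ({(x, y). cell_linked sc Lam le T c B x y}
               \<union> {(x, y). cell_linked sc Lam le T c B y x})\<^sup>*"

definition central :: "'a::ring_1 \<Rightarrow> bool" where
  "central z \<longleftrightarrow> (\<forall>x. z * x = x * z)"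

definition primitive_central_idem :: "'a::ring_1 \<Rightarrow> bool" where
  "primitive_central_idem b \<longleftrightarrow>
     central b \<and> b * b = b \<and> b \<noteq> 0 \<and>
     (\<forall>b1 b2. central b1 \<and> central b2 \<and> b1 * b1 = b1 \<and> b2 * b2 = b2 \<and> b1 * b2 = 0
        \<and> b = b1 + b2 \<longrightarrow> b1 = 0 \<or> b2 = 0)"

text \<open>The simple module L(l) = Delta(l)/Rad Delta(l) of A lies in the block of A
  with block idempotent b iff b acts as the identity on L(l).\<close>
definition in_block ::
  "('k::field \<Rightarrow> 'a::ring_1 \<Rightarrow> 'a) \<Rightarrow> 'l set \<Rightarrow> ('l \<Rightarrow> 'l \<Rightarrow> bool) \<Rightarrow> ('l \<Rightarrow> 't set)
    \<Rightarrow> ('l \<Rightarrow> 't \<Rightarrow> 't \<Rightarrow> 'a) \<Rightarrow> 'a \<Rightarrow> 'l \<Rightarrow> bool" where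
  "in_block sc Lam le T c b l \<longleftrightarrow>
     (\<forall>v\<in>cell_mod T l.
        (\<lambda>u. cell_act sc Lam le T c b l v u - v u) \<in> cell_rad sc Lam le T c l)"

definition same_block ::
  "('k::field \<Rightarrow> 'a::ring_1 \<Rightarrow> 'a) \<Rightarrow> 'l set \<Rightarrow> ('l \<Rightarrow> 'l \<Rightarrow> bool) \<Rightarrow> ('l \<Rightarrow> 't set)
    \<Rightarrow> ('l \<Rightarrow> 't \<Rightarrow> 't \<Rightarrow> 'a) \<Rightarrow> 'l \<Rightarrow> 'l \<Rightarrow> bool" where
  "same_block sc Lam le T c l m \<longleftrightarrow>
     (\<exists>b. primitive_central_idem b \<and> in_block sc Lam le T c b l \<and> in_block sc Lam le T c b m)"

definition T_idx :: "('i \<Rightarrow> 'a::ring_1) \<Rightarrow> ('l \<Rightarrow> 't set) \<Rightarrow> ('l \<Rightarrow> 't \<Rightarrow> 't \<Rightarrow> 'a)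
    \<Rightarrow> 'i \<Rightarrow> 'l \<Rightarrow> 't set" where
  "T_idx e T c i l = {t \<in> T l. \<forall>s\<in>T l. e i * c l t s = c l t s}"

definition Lam_idx :: "('i \<Rightarrow> 'a::ring_1) \<Rightarrow> 'l set \<Rightarrow> ('l \<Rightarrow> 't set) \<Rightarrow> ('l \<Rightarrow> 't \<Rightarrow> 't \<Rightarrow> 'a)
    \<Rightarrow> 'i \<Rightarrow> 'l set" where
  "Lam_idx e Lam T c i = {l \<in> Lam. T_idx e T c i l \<noteq> {}}"

definition corner :: "('i \<Rightarrow> 'a::ring_1) \<Rightarrow> 'i \<Rightarrow> 'a set" where
  "corner e i = {e i * x * e i | x. True}"

definition same_cell_block_idx ::
  "('k::field \<Rightarrow> 'a::ring_1 \<Rightarrow> 'a) \<Rightarrow> 'l set \<Rightarrow> ('l \<Rightarrow> 'l \<Rightarrow> bool) \<Rightarrow> ('l \<Rightarrow> 't set)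
    \<Rightarrow> ('l \<Rightarrow> 't \<Rightarrow> 't \<Rightarrow> 'a) \<Rightarrow> ('i \<Rightarrow> 'a) \<Rightarrow> 'i \<Rightarrow> 'l \<Rightarrow> 'l \<Rightarrow> bool" where
  "same_cell_block_idx sc Lam le T c e i l m \<longleftrightarrow>
     same_cell_block sc (Lam_idx e Lam T c i) le (T_idx e T c i) c (corner e i) l m"

definition idempotent_decomp ::
  "('a::ring_1 \<Rightarrow> 'a) \<Rightarrow> 'l set \<Rightarrow> ('l \<Rightarrow> 't set) \<Rightarrow> ('l \<Rightarrow> 't \<Rightarrow> 't \<Rightarrow> 'a)
    \<Rightarrow> 'i set \<Rightarrow> ('i \<Rightarrow> 'a) \<Rightarrow> bool" where
  "idempotent_decomp star Lam T c I e \<longleftrightarrow>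
     finite I \<and>
     (\<Sum>i\<in>I. e i) = 1 \<and>
     (\<forall>i\<in>I. e i \<noteq> 0 \<and> e i * e i = e i) \<and>
     (\<forall>i\<in>I. \<forall>j\<in>I. i \<noteq> j \<longrightarrow> e i * e j = 0) \<and>
     (\<forall>l\<in>Lam. \<forall>t\<in>T l. \<exists>i\<in>I. \<forall>s\<in>T l. e i * c l t s = c l t s) \<and>
     (\<forall>i\<in>I. star (e i) = e i)"

end

theory Submission
  imports Defs "HOL-Library.Function_Algebras"
begin

text \<open>
  Since \<open>\<Lambda> = \<Lambda>\<^sup>0\<close>, a central element acts on every cell module by a scalar; comparing
  the two actions on a common composition factor of a corner cell module shows that this scalar is
  constant on the cell-blocks of the corners, so linked elements lie in one block.

  Conversely, let \<open>S\<close> be a union of linkage classes. Adding the cells one at a time, from the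
  bottom of the poset to the top, one lifts modulo the ideals spanned by up-closed sets of cells an
  idempotent \<open>b\<close>, central and \<open>*\<close>-invariant modulo the ideal, which is the identity on
  \<open>L(\<nu>)\<close> for \<open>\<nu> \<in> S\<close> and zero on the others. When the cell of
  \<open>\<lambda> \<in> S\<close> is added, \<open>a = 1 - b\<close> can be corrected by an element of that cell so that it
  maps \<open>\<Delta>(\<lambda>)\<close> into \<open>Rad \<Delta>(\<lambda>)\<close>, and it kills \<open>Rad \<Delta>(\<lambda>)\<close>, because otherwise some
  \<open>e\<^sub>i\<close> would detect a composition factor \<open>L(\<nu>)\<close> with \<open>\<nu> \<notin> S\<close>. Hence \<open>a\<^sup>2\<close> and its
  image under \<open>*\<close> annihilate \<open>\<Delta>(\<lambda>)\<close>, and \<open>1 - a\<^sup>4\<close> is the next \<open>b\<close>. At the end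
  \<open>b\<close> is a central idempotent of the algebra separating \<open>S\<close> from its complement.
\<close>

section \<open>Coordinates with respect to the cellular basis\<close>

locale cellular =
  fixes sc :: "'k::field \<Rightarrow> 'a::ring_1 \<Rightarrow> 'a"
    and Lam :: "'l set" and le :: "'l \<Rightarrow> 'l \<Rightarrow> bool"
    and T :: "'l \<Rightarrow> 't set" and c :: "'l \<Rightarrow> 't \<Rightarrow> 't \<Rightarrow> 'a"
    and star :: "'a \<Rightarrow> 'a"
  assumes cellular: "cellular_algebra sc Lam le T c star"
begin

sublocale vs: vector_space sc
  using cellular unfolding cellular_algebra_def by (elim conjE)

abbreviation basis :: "'a set" where
  "basis \<equiv> {c l s t | l s t. l \<in> Lam \<and> s \<in> T l \<and> t \<in> T l}"

definition indices :: "('l \<times> 't \<times> 't) set" where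
  "indices = {(l, s, t). l \<in> Lam \<and> s \<in> T l \<and> t \<in> T l}"

definition coef :: "'l \<Rightarrow> 't \<Rightarrow> 't \<Rightarrow> 'a \<Rightarrow> 'k" where
  "coef l s t a = vs.representation basis a (c l s t)"

lemma scale_mult_left: "sc k x * y = sc k (x * y)"
  and scale_mult_right: "x * sc k y = sc k (x * y)"
proof -
  have "\<forall>k x y. sc k (x * y) = sc k x * y" "\<forall>k x y. sc k (x * y) = x * sc k y"
    using cellular unfolding cellular_algebra_def by - (elim conjE, assumption)+
  then show "sc k x * y = sc k (x * y)" "x * sc k y = sc k (x * y)" by (metis, metis)
qed

lemma finite_Lam: "finite Lam"
  and le_refl: "l \<in> Lam \<Longrightarrow> le l l"
  and finite_T: "l \<in> Lam \<Longrightarrow> finite (T l)"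
  and T_nonempty: "l \<in> Lam \<Longrightarrow> T l \<noteq> {}"
  and inj_c: "inj_on (\<lambda>(l, s, t). c l s t) indices"
  and indep: "\<not> vs.dependent basis"
  and span_basis: "vs.span basis = UNIV"
  and star_linear: "Vector_Spaces.linear sc sc star"
  and star_mult: "star (x * y) = star y * star x"
  and star_star [simp]: "star (star x) = x"
  and star_c: "l \<in> Lam \<Longrightarrow> s \<in> T l \<Longrightarrow> t \<in> T l \<Longrightarrow> star (c l s t) = c l t s"
  using cellular unfolding cellular_algebra_def indices_def by - (elim conjE, blast)+

lemma le_antisym: "l \<in> Lam \<Longrightarrow> m \<in> Lam \<Longrightarrow> le l m \<Longrightarrow> le m l \<Longrightarrow> l = m"
  and le_trans: "l \<in> Lam \<Longrightarrow> m \<in> Lam \<Longrightarrow> n \<in> Lam \<Longrightarrow> le l m \<Longrightarrow> le m n \<Longrightarrow> le l n"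
proof -
  have "\<forall>l\<in>Lam. \<forall>m\<in>Lam. le l m \<and> le m l \<longrightarrow> l = m"
    "\<forall>l\<in>Lam. \<forall>m\<in>Lam. \<forall>n\<in>Lam. le l m \<and> le m n \<longrightarrow> le l n"
    using cellular unfolding cellular_algebra_def by - (elim conjE, assumption)+
  then show "l \<in> Lam \<Longrightarrow> m \<in> Lam \<Longrightarrow> le l m \<Longrightarrow> le m l \<Longrightarrow> l = m"
    "l \<in> Lam \<Longrightarrow> m \<in> Lam \<Longrightarrow> n \<in> Lam \<Longrightarrow> le l m \<Longrightarrow> le m n \<Longrightarrow> le l n"
    by blast+
qed

lemma cell_rule:
  assumes "l \<in> Lam" "s \<in> T l"
  shows "\<exists>r. \<forall>t\<in>T l. a * c l s t - (\<Sum>u\<in>T l. sc (r u) (c l u t)) \<in> above sc Lam le T c l"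
proof -
  have "\<forall>a. \<forall>l\<in>Lam. \<forall>s\<in>T l. \<exists>r. \<forall>t\<in>T l.
      a * c l s t - (\<Sum>u\<in>T l. sc (r u) (c l u t)) \<in> above sc Lam le T c l"
    using cellular unfolding cellular_algebra_def by - (elim conjE, assumption)
  with assms show ?thesis by blast
qed

lemma star_add: "star (x + y) = star x + star y"
  and star_diff: "star (x - y) = star x - star y"
  and star_scale: "star (sc k x) = sc k (star x)"
  and star_zero [simp]: "star 0 = 0"
proof -
  interpret Vector_Spaces.linear sc sc star by (rule star_linear)
  show "star (x + y) = star x + star y" "star (x - y) = star x - star y"
    "star (sc k x) = sc k (star x)" "star 0 = 0"
    by (simp_all add: add diff scale)
qed

lemma star_one [simp]: "star 1 = 1"
  by (metis mult.right_neutral mult.left_neutral star_mult star_star)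

lemma finite_indices: "finite indices"
proof -
  have "indices = (SIGMA l:Lam. T l \<times> T l)" by (auto simp: indices_def)
  then show ?thesis using finite_Lam finite_T by auto
qed

lemma basis_eq: "basis = (\<lambda>(l, s, t). c l s t) ` indices"
  by (force simp: indices_def)

lemma finite_basis: "finite basis"
  unfolding basis_eq using finite_indices by simp

lemma coef_add [simp]: "coef l s t (a + b) = coef l s t a + coef l s t b"
  and coef_diff [simp]: "coef l s t (a - b) = coef l s t a - coef l s t b"
  and coef_scale [simp]: "coef l s t (sc k a) = k * coef l s t a"
  and coef_zero [simp]: "coef l s t 0 = 0"
  by (simp_all add: coef_def vs.representation_add[OF indep] vs.representation_diff[OF indep]
      vs.representation_scale[OF indep] vs.representation_zero span_basis)

lemma coef_sum [simp]: "coef l s t (\<Sum>x\<in>A. f x) = (\<Sum>x\<in>A. coef l s t (f x))"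
  by (simp add: coef_def vs.representation_sum[OF indep] span_basis)

lemma coef_c:
  assumes "l \<in> Lam" "s \<in> T l" "t \<in> T l" "m \<in> Lam" "x \<in> T m" "y \<in> T m"
  shows "coef l s t (c m x y) = (if l = m \<and> s = x \<and> t = y then 1 else 0)"
proof -
  have "c m x y \<in> basis" using assms by blast
  moreover have "c l s t = c m x y \<longleftrightarrow> l = m \<and> s = x \<and> t = y"
    using inj_onD[OF inj_c, of "(l, s, t)" "(m, x, y)"] assms by (auto simp: indices_def)
  ultimately show ?thesis
    by (simp add: coef_def vs.representation_basis[OF indep])
qed

lemma expand: "(\<Sum>(l, s, t)\<in>indices. sc (coef l s t a) (c l s t)) = a"
proof -
  have "(\<Sum>b\<in>basis. sc (vs.representation basis a b) b) = a"
    by (rule vs.sum_representation_eq[OF indep _ finite_basis]) (simp_all add: span_basis)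
  then show ?thesis
    unfolding basis_eq sum.reindex[OF inj_c]
    by (simp add: coef_def basis_eq case_prod_unfold)
qed

lemma coef_eqI:
  assumes "\<And>l s t. l \<in> Lam \<Longrightarrow> s \<in> T l \<Longrightarrow> t \<in> T l \<Longrightarrow> coef l s t a = coef l s t b"
  shows "a = b"
proof -
  have "(\<Sum>(l, s, t)\<in>indices. sc (coef l s t a) (c l s t)) =
        (\<Sum>(l, s, t)\<in>indices. sc (coef l s t b) (c l s t))"
    by (rule sum.cong) (auto simp: indices_def assms)
  then show ?thesis by (simp add: expand)
qed

text \<open>An element is the finite sum of its coordinates times basis vectors, so an additive
  property has to be checked only on multiples of the basis vectors in the allowed support.
  Arguments by linearity go through this rule.\<close>

lemma support_induct:
  assumes supp: "\<And>l s t. l \<in> Lam \<Longrightarrow> s \<in> T l \<Longrightarrow> t \<in> T l \<Longrightarrow> \<not> Q l s t \<Longrightarrow> coef l s t a = 0"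
    and zero: "P 0" and add: "\<And>x y. P x \<Longrightarrow> P y \<Longrightarrow> P (x + y)"
    and basis: "\<And>k l s t. l \<in> Lam \<Longrightarrow> s \<in> T l \<Longrightarrow> t \<in> T l \<Longrightarrow> Q l s t \<Longrightarrow> P (sc k (c l s t))"
  shows "P a"
proof -
  have "P (\<Sum>(l, s, t)\<in>J. sc (coef l s t a) (c l s t))" if "finite J" "J \<subseteq> indices" for J
    using that
  proof (induction J)
    case (insert j J)
    obtain l s t where j: "j = (l, s, t)" by (cases j)
    with insert.prems have "l \<in> Lam" "s \<in> T l" "t \<in> T l" by (auto simp: indices_def)
    then have "P (sc (coef l s t a) (c l s t))"
      using supp[of l s t] basis[of l s t] zero by (cases "Q l s t") auto
    with insert show ?case by (auto simp: j intro: add)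
  qed (simp add: zero)
  from this[OF finite_indices subset_refl] show ?thesis by (simp add: expand)
qed

text \<open>By independence, the span of part of the basis is cut out by the vanishing of the
  remaining coordinates.\<close>

lemma span_iff:
  assumes "\<And>l s t. Q l s t \<Longrightarrow> l \<in> Lam \<and> s \<in> T l \<and> t \<in> T l"
  shows "a \<in> vs.span {c l s t | l s t. Q l s t} \<longleftrightarrow>
    (\<forall>l\<in>Lam. \<forall>s\<in>T l. \<forall>t\<in>T l. \<not> Q l s t \<longrightarrow> coef l s t a = 0)"
    (is "_ \<longleftrightarrow> ?R a")
proof
  assume "a \<in> vs.span {c l s t | l s t. Q l s t}"
  then show "?R a"
  proof (induction rule: vs.span_induct_alt)
    case (step k x y)
    then obtain m u v where x: "x = c m u v" "Q m u v" by blast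
    from assms[OF x(2)] step x show ?case by (auto simp: coef_c)
  qed simp
next
  assume R: "?R a"
  show "a \<in> vs.span {c l s t | l s t. Q l s t}"
  proof (rule support_induct[where Q=Q])
    show "coef l s t a = 0" if "l \<in> Lam" "s \<in> T l" "t \<in> T l" "\<not> Q l s t" for l s t
      using R that by blast
    show "sc k (c l s t) \<in> vs.span {c l s t |l s t. Q l s t}" if "Q l s t" for k l s t
      by (rule vs.span_scale, rule vs.span_base) (use that in blast)
  qed (auto intro: vs.span_add vs.span_zero)
qed

text \<open>Admitting a subposet and smaller index sets lets \<open>above\<close> for a corner datum
  be described by coordinates in the full algebra.\<close>

lemma above_iff:
  assumes "Lam' \<subseteq> Lam" "\<And>l. T' l \<subseteq> T l"
  shows "a \<in> above sc Lam' le T' c l \<longleftrightarrow>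
    (\<forall>m\<in>Lam. \<forall>x\<in>T m. \<forall>y\<in>T m.
      \<not> (m \<in> Lam' \<and> le l m \<and> m \<noteq> l \<and> x \<in> T' m \<and> y \<in> T' m) \<longrightarrow> coef m x y a = 0)"
  unfolding above_def by (rule span_iff) (use assms in blast)

lemmas above_iff_full = above_iff[OF subset_refl subset_refl]

lemma coef_star:
  assumes "l \<in> Lam" "s \<in> T l" "t \<in> T l"
  shows "coef l s t (star a) = coef l t s a"
  by (rule support_induct[where Q="\<lambda>_ _ _. True" and a=a])
    (use assms in \<open>auto simp: star_add star_scale star_c coef_c\<close>)

section \<open>Cell modules\<close>

abbreviation R where "R \<equiv> cell_coeff sc Lam le T c"
abbreviation act where "act \<equiv> cell_act sc Lam le T c"
abbreviation phi where "phi \<equiv> form_coeff sc Lam le T c"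
abbreviation Delta :: "'l \<Rightarrow> ('t \<Rightarrow> 'k) set" where "Delta \<equiv> cell_mod T"
abbreviation form where "form \<equiv> cell_form sc Lam le T c"
abbreviation Rad where "Rad \<equiv> cell_rad sc Lam le T c"

lemma R_spec:
  assumes "l \<in> Lam" "s \<in> T l" "t \<in> T l"
  shows "a * c l s t - (\<Sum>w\<in>T l. sc (R a l w s) (c l w t)) \<in> above sc Lam le T c l"
  using someI_ex[OF cell_rule[OF assms(1,2), of a]] assms(3) by (simp add: cell_coeff_def)

text \<open>The error term of the cellular rule has no coordinate in the cell \<open>l\<close>
  itself, so the structure constants picked by \<open>SOME\<close> are coordinates of the product
  and thereby determined on \<open>T l\<close>.\<close>

lemma coef_mult_same:
  assumes "l \<in> Lam" "s \<in> T l" "t \<in> T l" "x \<in> T l" "y \<in> T l"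
  shows "coef l x y (a * c l s t) = (if y = t then R a l x s else 0)"
proof -
  have "coef l x y (a * c l s t) = (\<Sum>w\<in>T l. R a l w s * coef l x y (c l w t))"
    using R_spec[of l s t a] assms unfolding above_iff_full by auto
  also have "\<dots> = (\<Sum>w\<in>T l. if w = x then (if y = t then R a l x s else 0) else 0)"
    by (rule sum.cong) (use assms in \<open>auto simp: coef_c\<close>)
  finally show ?thesis using assms finite_T by simp
qed

lemma coef_mult_zero:
  assumes "l \<in> Lam" "s \<in> T l" "t \<in> T l" "m \<in> Lam" "x \<in> T m" "y \<in> T m" "\<not> le l m"
  shows "coef m x y (a * c l s t) = 0"
proof -
  have "m \<noteq> l" using assms le_refl by auto
  have "coef m x y (a * c l s t) = (\<Sum>w\<in>T l. R a l w s * coef m x y (c l w t))"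
    using R_spec[of l s t a] assms unfolding above_iff_full by auto
  also have "\<dots> = 0"
    by (rule sum.neutral) (use assms \<open>m \<noteq> l\<close> in \<open>auto simp: coef_c\<close>)
  finally show ?thesis .
qed

text \<open>Applying \<open>star\<close> turns right multiplication by \<open>a\<close> into left
  multiplication by \<open>star a\<close> with the two indices exchanged.\<close>

lemma coef_rmult_same:
  assumes "l \<in> Lam" "s \<in> T l" "t \<in> T l" "x \<in> T l" "y \<in> T l"
  shows "coef l x y (c l s t * a) = (if x = s then R (star a) l y t else 0)"
proof -
  have "coef l x y (c l s t * a) = coef l y x (star a * c l t s)"
    using coef_star[of l x y "star a * c l t s"] assms by (simp add: star_mult star_c)
  then show ?thesis using assms by (simp add: coef_mult_same)
qed

lemma coef_rmult_zero:
  assumes "l \<in> Lam" "s \<in> T l" "t \<in> T l" "m \<in> Lam" "x \<in> T m" "y \<in> T m" "\<not> le l m"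
  shows "coef m x y (c l s t * a) = 0"
proof -
  have "coef m x y (c l s t * a) = coef m y x (star a * c l t s)"
    using coef_star[of m x y "star a * c l t s"] assms by (simp add: star_mult star_c)
  then show ?thesis using assms by (simp add: coef_mult_zero)
qed

lemma R_eq_coef: "l \<in> Lam \<Longrightarrow> s \<in> T l \<Longrightarrow> u \<in> T l \<Longrightarrow> R a l u s = coef l u s (a * c l s s)"
  by (simp add: coef_mult_same)

section \<open>Two-sided ideals attached to up-closed sets of cells\<close>

definition ideal :: "'l set \<Rightarrow> 'a set" where
  "ideal G = {a. \<forall>m\<in>Lam. \<forall>x\<in>T m. \<forall>y\<in>T m. m \<notin> G \<longrightarrow> coef m x y a = 0}"

definition up_closed :: "'l set \<Rightarrow> bool" where
  "up_closed G \<longleftrightarrow> G \<subseteq> Lam \<and> (\<forall>l\<in>G. \<forall>m\<in>Lam. le l m \<longrightarrow> m \<in> G)"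

lemma ideal_subspace: "vs.subspace (ideal G)"
  by (auto simp: vs.subspace_def ideal_def)

lemmas ideal_add = vs.subspace_add[OF ideal_subspace]
  and ideal_neg = vs.subspace_neg[OF ideal_subspace]
  and ideal_scale = vs.subspace_scale[OF ideal_subspace]
  and ideal_zero = vs.subspace_0[OF ideal_subspace]

lemma ideal_induct [consumes 1, case_names zero add basis]:
  assumes "z \<in> ideal G" "P 0" "\<And>x y. P x \<Longrightarrow> P y \<Longrightarrow> P (x + y)"
    "\<And>k l s t. l \<in> Lam \<Longrightarrow> s \<in> T l \<Longrightarrow> t \<in> T l \<Longrightarrow> l \<in> G \<Longrightarrow> P (sc k (c l s t))"
  shows "P z"
  by (rule support_induct[where Q="\<lambda>l _ _. l \<in> G"]) (use assms in \<open>auto simp: ideal_def\<close>)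

lemma ideal_star: "z \<in> ideal G \<Longrightarrow> star z \<in> ideal G"
  by (simp add: ideal_def coef_star)

text \<open>A left multiple of \<open>c l s t\<close> has coordinates only in cells \<open>m\<close>
  with \<open>le l m\<close>, and up-closedness keeps these inside \<open>G\<close>.\<close>

lemma ideal_mult_left:
  assumes "up_closed G" "z \<in> ideal G"
  shows "a * z \<in> ideal G"
  using assms(2)
proof (induction rule: ideal_induct)
  case (basis k l s t)
  have "a * c l s t \<in> ideal G"
    using assms(1) basis coef_mult_zero[of l s t] unfolding ideal_def up_closed_def by blast
  then show ?case by (simp add: scale_mult_right ideal_scale)
qed (auto simp: ideal_zero distrib_left ideal_add)

lemma ideal_mult_right:
  assumes "up_closed G" "z \<in> ideal G"
  shows "z * a \<in> ideal G"
  using ideal_star[OF ideal_mult_left[OF assms(1) ideal_star[OF assms(2)], of "star a"]]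
  by (simp add: star_mult)

lemma ideal_empty: "ideal {} = {0}"
  by (auto simp: ideal_def intro: coef_eqI)

lemma up_closed_above: "l \<in> Lam \<Longrightarrow> up_closed {m \<in> Lam. le l m \<and> m \<noteq> l}"
  unfolding up_closed_def by (blast intro: le_trans dest: le_antisym)

lemma above_eq_ideal: "above sc Lam le T c l = ideal {m \<in> Lam. le l m \<and> m \<noteq> l}"
  by (auto simp: above_iff_full ideal_def)

lemma R_ideal_above:
  assumes "l \<in> Lam" "s \<in> T l" "u \<in> T l" "z \<in> ideal {m \<in> Lam. le l m \<and> m \<noteq> l}"
  shows "coef l u s (a * z) = 0"
  using ideal_mult_left[OF up_closed_above[OF assms(1)] assms(4), of a] assms(1-3)
  by (auto simp: ideal_def)

lemma R_add: "l \<in> Lam \<Longrightarrow> s \<in> T l \<Longrightarrow> u \<in> T l \<Longrightarrow> R (a + b) l u s = R a l u s + R b l u s"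
  and R_diff: "l \<in> Lam \<Longrightarrow> s \<in> T l \<Longrightarrow> u \<in> T l \<Longrightarrow> R (a - b) l u s = R a l u s - R b l u s"
  and R_scale: "l \<in> Lam \<Longrightarrow> s \<in> T l \<Longrightarrow> u \<in> T l \<Longrightarrow> R (sc k a) l u s = k * R a l u s"
  and R_zero: "l \<in> Lam \<Longrightarrow> s \<in> T l \<Longrightarrow> u \<in> T l \<Longrightarrow> R 0 l u s = 0"
  and R_one: "l \<in> Lam \<Longrightarrow> s \<in> T l \<Longrightarrow> u \<in> T l \<Longrightarrow> R 1 l u s = (if u = s then 1 else 0)"
  by (simp_all add: R_eq_coef distrib_right left_diff_distrib scale_mult_left coef_c)

text \<open>Expand \<open>b * c l s s\<close> in the cell \<open>l\<close>. The error lies in the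
  left ideal above \<open>l\<close>, so multiplying it by \<open>a\<close> creates no coordinate at
  \<open>l\<close>. This is what makes the cell module a module.\<close>

lemma R_mult:
  assumes "l \<in> Lam" "s \<in> T l" "u \<in> T l"
  shows "R (a * b) l u s = (\<Sum>w\<in>T l. R a l u w * R b l w s)"
proof -
  let ?z = "b * c l s s - (\<Sum>w\<in>T l. sc (R b l w s) (c l w s))"
  have "?z \<in> ideal {m \<in> Lam. le l m \<and> m \<noteq> l}"
    using R_spec[of l s s b] assms by (simp add: above_eq_ideal)
  then have "coef l u s (a * ?z) = 0" using R_ideal_above assms by blast
  then have "coef l u s (a * (b * c l s s)) = (\<Sum>w\<in>T l. R b l w s * coef l u s (a * c l w s))"
    by (simp add: right_diff_distrib sum_distrib_left scale_mult_right)
  then show ?thesis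
    using assms by (simp add: R_eq_coef[of l s u "a * b"] mult.assoc coef_mult_same mult.commute)
qed

text \<open>The coordinate of \<open>c l u s * c l t b\<close> at \<open>(u, b)\<close> is computed
  by the left rule and by the right rule. One result does not involve \<open>b\<close>, the other
  does not involve \<open>u\<close>, so the value depends on neither.\<close>

lemma R_c_eq:
  assumes "l \<in> Lam" "s \<in> T l" "t \<in> T l" "u \<in> T l" "b \<in> T l"
  shows "R (c l u s) l u t = R (c l b t) l b s"
  using coef_mult_same[of l t b u b "c l u s"] coef_rmult_same[of l u s u b "c l t b"] assms
  by (simp add: star_c)

text \<open>Existence of the scalar rests on \<open>R_c_eq\<close>, its uniqueness on the coordinate
  at \<open>(u, u)\<close>; hence the choice in \<open>form_coeff\<close> returns this structure
  constant.\<close>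

lemma phi_eq:
  assumes "l \<in> Lam" "s \<in> T l" "t \<in> T l" "u \<in> T l"
  shows "phi l s t = R (c l u s) l u t"
proof -
  let ?P = "\<lambda>p::'k. \<forall>u\<in>T l. \<forall>b\<in>T l. c l u s * c l t b - sc p (c l u b) \<in> above sc Lam le T c l"
  have uniq: "p = R (c l u s) l u t" if "?P p" for p
  proof -
    from that assms have "c l u s * c l t u - sc p (c l u u) \<in> above sc Lam le T c l" by blast
    with assms have "coef l u u (c l u s * c l t u - sc p (c l u u)) = 0"
      unfolding above_iff_full by blast
    with assms show ?thesis by (simp add: coef_mult_same coef_c)
  qed
  have "?P (R (c l u s) l u t)"
  proof (intro ballI)
    fix v b assume vb: "v \<in> T l" "b \<in> T l"
    have K: "R (c l v s) l v t = R (c l u s) l u t"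
      using R_c_eq[of l s t v u] R_c_eq[of l s t u u] assms vb by simp
    show "c l v s * c l t b - sc (R (c l u s) l u t) (c l v b) \<in> above sc Lam le T c l"
      unfolding above_iff_full
    proof (intro ballI impI)
      fix m x y assume *: "m \<in> Lam" "x \<in> T m" "y \<in> T m"
        "\<not> (m \<in> Lam \<and> le l m \<and> m \<noteq> l \<and> x \<in> T m \<and> y \<in> T m)"
      show "coef m x y (c l v s * c l t b - sc (R (c l u s) l u t) (c l v b)) = 0"
      proof (cases "m = l")
        case True
        then show ?thesis
          using * assms vb K coef_mult_same[of l t b x y "c l v s"]
            coef_rmult_same[of l v s x y "c l t b"]
          by (auto simp: coef_c split: if_splits)
      next
        case False
        then show ?thesis using * assms vb by (simp add: coef_mult_zero coef_c)
      qed
    qed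
  qed
  then have "?P (SOME p. ?P p)" by (rule someI)
  then show ?thesis using uniq by (simp add: form_coeff_def)
qed

lemma phi_sym: "l \<in> Lam \<Longrightarrow> s \<in> T l \<Longrightarrow> t \<in> T l \<Longrightarrow> phi l s t = phi l t s"
  using phi_eq[of l s t s] phi_eq[of l t s s] R_c_eq[of l s t s s] by simp

lemma R_c_same:
  assumes "l \<in> Lam" "s \<in> T l" "u \<in> T l" "x \<in> T l" "y \<in> T l"
  shows "R (c l x y) l u s = (if u = x then phi l y s else 0)"
proof (cases "u = x")
  case False
  then show ?thesis using assms by (simp add: R_eq_coef coef_rmult_same)
qed (use assms in \<open>simp add: phi_eq[of l y s x]\<close>)

lemma R_c_zero:
  assumes "l \<in> Lam" "s \<in> T l" "u \<in> T l" "m \<in> Lam" "x \<in> T m" "y \<in> T m" "\<not> le m l"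
  shows "R (c m x y) l u s = 0"
  using assms by (simp add: R_eq_coef coef_rmult_zero)

text \<open>The product \<open>z * c l s s\<close> stays in \<open>ideal G\<close>, which has no
  coordinate at \<open>l\<close>. So the ideal acts as zero on every cell module outside
  \<open>G\<close>.\<close>

lemma R_ideal_zero:
  assumes "l \<in> Lam" "s \<in> T l" "u \<in> T l" "up_closed G" "l \<notin> G" "z \<in> ideal G"
  shows "R z l u s = 0"
  using ideal_mult_right[OF assms(4,6), of "c l s s"] assms
  by (simp add: R_eq_coef ideal_def)

text \<open>Both sides compute one coordinate of \<open>c l s s * a * c l t t\<close>, directly and
  after applying \<open>star\<close>. In terms of the form, \<open>star a\<close> is adjoint to
  \<open>a\<close>.\<close>

lemma phi_adjoint:
  assumes "l \<in> Lam" "s \<in> T l" "t \<in> T l"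
  shows "(\<Sum>u\<in>T l. R (star a) l u s * phi l u t) = (\<Sum>u\<in>T l. R a l u t * phi l s u)"
proof -
  have "(\<Sum>u\<in>T l. R a l u t * phi l s u) = (\<Sum>u\<in>T l. R (c l s s) l s u * R a l u t)"
    by (rule sum.cong) (use assms in \<open>auto simp: R_c_same mult.commute\<close>)
  also have "\<dots> = coef l s t (c l s s * a * c l t t)"
    using assms by (simp add: R_mult coef_mult_same)
  also have "\<dots> = coef l t s (star (c l s s * a * c l t t))"
    by (rule coef_star[symmetric]) (use assms in auto)
  also have "\<dots> = coef l t s (c l t t * star a * c l s s)"
    using assms by (simp add: star_mult star_c mult.assoc)
  also have "\<dots> = (\<Sum>u\<in>T l. R (c l t t) l t u * R (star a) l u s)"
    using assms by (simp add: R_mult coef_mult_same)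
  also have "\<dots> = (\<Sum>u\<in>T l. R (star a) l u s * phi l u t)"
  proof (rule sum.cong[OF refl])
    fix u assume "u \<in> T l"
    with assms show "R (c l t t) l t u * R (star a) l u s = R (star a) l u s * phi l u t"
      using phi_sym[of l u t] by (simp add: R_c_same)
  qed
  finally show ?thesis by simp
qed

end

section \<open>Coefficient vectors as a vector space\<close>

definition fscale :: "'k::field \<Rightarrow> ('t \<Rightarrow> 'k) \<Rightarrow> 't \<Rightarrow> 'k" where
  "fscale k v = (\<lambda>u. k * v u)"

lemma fscale_apply [simp]: "fscale k v u = k * v u"
  by (simp add: fscale_def)

interpretation fs: vector_space fscale
  by unfold_locales (auto simp: fscale_def fun_eq_iff algebra_simps)

interpretation fp: vector_space_pair fscale fscale ..

definition unit :: "'t \<Rightarrow> 't \<Rightarrow> 'k::field" where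
  "unit x = (\<lambda>u. if u = x then 1 else 0)"

text \<open>A basis of \<open>U\<close> together with a vector of \<open>W\<close> outside
  \<open>U\<close> is still independent, and the finite set \<open>F\<close> bounds all
  cardinalities involved. Both the descent to primitive idempotents and the construction of
  composition series terminate by this.\<close>

lemma (in vector_space) dim_psubset_of_finite_span:
  assumes "subspace U" "subspace W" "U \<subset> W" "W \<subseteq> span F" "finite F"
  shows "dim U < dim W"
proof -
  obtain B where B: "B \<subseteq> U" "independent B" "U \<subseteq> span B" "card B = dim U"
    using basis_exists by blast
  obtain C where C: "C \<subseteq> W" "independent C" "W \<subseteq> span C" "card C = dim W"
    using basis_exists by blast
  obtain x where x: "x \<in> W" "x \<notin> U" using assms(3) by blast
  have "finite C" using independent_span_bound[OF assms(5) C(2)] C(1) assms(4) by blast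
  have "span B \<subseteq> U" using B(1) assms(1) by (rule span_minimal)
  then have "x \<notin> span B" using x by blast
  then have ind: "independent (insert x B)" using B(2) by (simp add: independent_insertI)
  have "insert x B \<subseteq> span C" using x B(1) C(3) assms(3) by blast
  from independent_span_bound[OF \<open>finite C\<close> ind this]
  have "finite (insert x B)" "card (insert x B) \<le> card C" by auto
  moreover have "x \<notin> B" using B(1) x by blast
  ultimately show ?thesis using B(4) C(4) by simp
qed

lemma Delta_subspace: "fs.subspace (cell_mod T l)"
  by (auto simp: fs.subspace_def cell_mod_def)

section \<open>Module structure of the cell modules\<close>

context cellular
begin

lemma act_apply: "act a l v u = (if u \<in> T l then \<Sum>s\<in>T l. R a l u s * v s else 0)"
  by (simp add: cell_act_def)

lemma act_in_Delta [simp]: "act a l v \<in> Delta l"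
  by (simp add: cell_act_def cell_mod_def)

lemma act_add_right: "act a l (v + w) = act a l v + act a l w"
  and act_diff_right: "act a l (v - w) = act a l v - act a l w"
  and act_fscale: "act a l (fscale k v) = fscale k (act a l v)"
  and act_zero_right [simp]: "act a l 0 = 0"
  by (auto simp: fun_eq_iff act_apply sum.distrib sum_subtractf algebra_simps sum_distrib_left)

lemma act_add_left: "l \<in> Lam \<Longrightarrow> act (a + b) l v = act a l v + act b l v"
  and act_diff_left: "l \<in> Lam \<Longrightarrow> act (a - b) l v = act a l v - act b l v"
  and act_scale_left: "l \<in> Lam \<Longrightarrow> act (sc k a) l v = fscale k (act a l v)"
  and act_zero_left: "l \<in> Lam \<Longrightarrow> act 0 l v = 0"
  by (auto simp: fun_eq_iff act_apply R_add R_diff R_scale R_zero sum.distrib sum_subtractf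
      algebra_simps sum_distrib_left)

lemma act_sum_left: "l \<in> Lam \<Longrightarrow> act (\<Sum>i\<in>A. f i) l v = (\<Sum>i\<in>A. act (f i) l v)"
  by (induction A rule: infinite_finite_induct) (auto simp: act_zero_left act_add_left)

lemma act_one: "l \<in> Lam \<Longrightarrow> v \<in> Delta l \<Longrightarrow> act 1 l v = v"
  using finite_T[of l] by (auto simp: fun_eq_iff act_apply R_one cell_mod_def if_distrib[of "\<lambda>x. x * _"] cong: if_cong)

lemma act_mult:
  assumes "l \<in> Lam"
  shows "act (a * b) l v = act a l (act b l v)"
proof
  fix u
  show "act (a * b) l v u = act a l (act b l v) u"
  proof (cases "u \<in> T l")
    case True
    have "(\<Sum>s\<in>T l. R (a * b) l u s * v s) = (\<Sum>s\<in>T l. \<Sum>w\<in>T l. R a l u w * (R b l w s * v s))"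
      using assms True by (simp add: R_mult sum_distrib_right mult.assoc)
    also have "\<dots> = (\<Sum>w\<in>T l. \<Sum>s\<in>T l. R a l u w * (R b l w s * v s))" by (rule sum.swap)
    finally show ?thesis using True by (simp add: act_apply sum_distrib_left)
  qed (simp add: act_apply)
qed

lemma act_ideal_zero:
  assumes "l \<in> Lam" "up_closed G" "l \<notin> G" "z \<in> ideal G"
  shows "act z l v = 0"
  using assms by (auto simp: fun_eq_iff act_apply R_ideal_zero)

text \<open>Cell modules outside \<open>G\<close> are modules over the quotient by
  \<open>ideal G\<close>, so acting elements may be changed modulo that ideal.\<close>

lemma act_cong_ideal:
  assumes "l \<in> Lam" "up_closed G" "l \<notin> G" "a - b \<in> ideal G"
  shows "act a l v = act b l v"
  using act_ideal_zero[OF assms, of v] assms(1) by (simp add: act_diff_left)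

lemma unit_in_Delta: "x \<in> T l \<Longrightarrow> unit x \<in> Delta l"
  by (auto simp: unit_def cell_mod_def)

lemma act_unit: "l \<in> Lam \<Longrightarrow> s \<in> T l \<Longrightarrow> u \<in> T l \<Longrightarrow> act a l (unit s) u = R a l u s"
  using finite_T[of l] by (simp add: act_apply unit_def if_distrib[of "\<lambda>x. _ * x"] cong: if_cong)

section \<open>The bilinear form and its radical\<close>

definition pairing :: "'l \<Rightarrow> 't \<Rightarrow> ('t \<Rightarrow> 'k) \<Rightarrow> 'k" where
  "pairing l s v = (\<Sum>t\<in>T l. phi l s t * v t)"

lemma pairing_add: "pairing l s (v + w) = pairing l s v + pairing l s w"
  and pairing_diff: "pairing l s (v - w) = pairing l s v - pairing l s w"
  and pairing_fscale: "pairing l s (fscale k v) = k * pairing l s v"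
  and pairing_zero [simp]: "pairing l s 0 = 0"
  by (simp_all add: pairing_def algebra_simps sum.distrib sum_subtractf sum_distrib_left)

lemma pairing_unit: "l \<in> Lam \<Longrightarrow> t \<in> T l \<Longrightarrow> pairing l s (unit t) = phi l s t"
  using finite_T[of l] by (simp add: pairing_def unit_def if_distrib[of "\<lambda>x. _ * x"] cong: if_cong)

lemma form_eq: "l \<in> Lam \<Longrightarrow> form l v w = (\<Sum>s\<in>T l. v s * pairing l s w)"
  by (simp add: cell_form_def pairing_def sum_distrib_left algebra_simps)

lemma form_sym:
  assumes "l \<in> Lam"
  shows "form l v w = form l w v"
proof -
  have "form l v w = (\<Sum>t\<in>T l. \<Sum>s\<in>T l. v s * w t * phi l s t)"
    unfolding cell_form_def by (rule sum.swap)
  also have "\<dots> = form l w v"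
    unfolding cell_form_def
    by (intro sum.cong refl) (simp add: phi_sym[OF assms] mult.commute)
  finally show ?thesis .
qed

text \<open>By bilinearity and symmetry it suffices to test against coordinate vectors: the radical
  is the kernel of the Gram matrix, whose rows are the functionals
  \<open>pairing l s\<close>.\<close>

lemma Rad_iff:
  assumes "l \<in> Lam"
  shows "v \<in> Rad l \<longleftrightarrow> v \<in> Delta l \<and> (\<forall>s\<in>T l. pairing l s v = 0)"
proof
  assume v: "v \<in> Rad l"
  have "pairing l s v = 0" if "s \<in> T l" for s
  proof -
    have "form l v (unit s) = 0" using v unit_in_Delta[OF that] by (simp add: cell_rad_def)
    then have "(\<Sum>x\<in>T l. unit s x * pairing l x v) = 0"
      using form_sym[OF assms] form_eq[OF assms] by metis
    then show ?thesis
      using finite_T[OF assms] that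
      by (simp add: unit_def if_distrib[of "\<lambda>x. x * _"] cong: if_cong)
  qed
  with v show "v \<in> Delta l \<and> (\<forall>s\<in>T l. pairing l s v = 0)" by (simp add: cell_rad_def)
next
  assume "v \<in> Delta l \<and> (\<forall>s\<in>T l. pairing l s v = 0)"
  moreover from this have "form l w v = 0" for w by (simp add: form_eq[OF assms])
  ultimately show "v \<in> Rad l"
    unfolding cell_rad_def using form_sym[OF assms, of v] by simp
qed

lemma Rad_subspace: "l \<in> Lam \<Longrightarrow> fs.subspace (Rad l)"
  unfolding fs.subspace_def by (auto simp: Rad_iff pairing_add pairing_fscale cell_mod_def)

text \<open>Basis elements of the cell act on their own cell module as rank-one operators. This is
  how the form controls submodules and homomorphisms.\<close>

lemma act_c:
  assumes "l \<in> Lam" "x \<in> T l" "y \<in> T l"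
  shows "act (c l x y) l v = fscale (pairing l y v) (unit x)"
  using assms by (auto simp: fun_eq_iff act_apply R_c_same unit_def pairing_def)

lemma pairing_act:
  assumes "l \<in> Lam" "s \<in> T l"
  shows "pairing l s (act a l v) = (\<Sum>u\<in>T l. R (star a) l u s * pairing l u v)"
proof -
  have "pairing l s (act a l v) = (\<Sum>t\<in>T l. \<Sum>w\<in>T l. phi l s t * (R a l t w * v w))"
    by (simp add: pairing_def act_apply sum_distrib_left)
  also have "\<dots> = (\<Sum>w\<in>T l. \<Sum>t\<in>T l. phi l s t * (R a l t w * v w))" by (rule sum.swap)
  also have "\<dots> = (\<Sum>w\<in>T l. (\<Sum>t\<in>T l. R a l t w * phi l s t) * v w)"
    by (simp add: sum_distrib_left sum_distrib_right mult_ac)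
  also have "\<dots> = (\<Sum>w\<in>T l. (\<Sum>u\<in>T l. R (star a) l u s * phi l u w) * v w)"
    using assms by (simp add: phi_adjoint)
  also have "\<dots> = (\<Sum>w\<in>T l. \<Sum>u\<in>T l. R (star a) l u s * phi l u w * v w)"
    by (simp add: sum_distrib_right)
  also have "\<dots> = (\<Sum>u\<in>T l. \<Sum>w\<in>T l. R (star a) l u s * phi l u w * v w)" by (rule sum.swap)
  finally show ?thesis by (simp add: pairing_def sum_distrib_left mult.assoc)
qed

lemma act_Rad: "l \<in> Lam \<Longrightarrow> v \<in> Rad l \<Longrightarrow> act a l v \<in> Rad l"
  by (simp add: Rad_iff pairing_act)

text \<open>If the image of \<open>a\<close> is orthogonal to everything, then so is the image of
  its adjoint.\<close>

lemma act_star_Rad: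
  assumes l: "l \<in> Lam" and a: "\<And>v. v \<in> Delta l \<Longrightarrow> act a l v \<in> Rad l"
  shows "act (star a) l v \<in> Rad l"
proof -
  have "pairing l s (act (star a) l v) = 0" if s: "s \<in> T l" for s
  proof -
    have "act a l (unit s) \<in> Rad l" using a unit_in_Delta[OF s] .
    then have z: "pairing l t (act a l (unit s)) = 0" if "t \<in> T l" for t
      using that l by (simp add: Rad_iff)
    have "pairing l s (act (star a) l v) = (\<Sum>u\<in>T l. \<Sum>t\<in>T l. R a l u s * phi l u t * v t)"
      unfolding pairing_act[OF l s] by (simp add: pairing_def sum_distrib_left mult.assoc)
    also have "\<dots> = (\<Sum>t\<in>T l. \<Sum>u\<in>T l. R a l u s * phi l u t * v t)" by (rule sum.swap)
    also have "\<dots> = (\<Sum>t\<in>T l. pairing l t (act a l (unit s)) * v t)"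
      unfolding pairing_def sum_distrib_right
      by (intro sum.cong refl) (simp add: act_unit l s phi_sym[OF l])
    finally show ?thesis using z by simp
  qed
  then show ?thesis using l by (simp add: Rad_iff)
qed

text \<open>Left multiplication acts on a column of the cell \<open>l\<close> as it does on the cell
  module. If \<open>g\<close> annihilates that module, the coordinates at \<open>l\<close> disappear
  and the product drops to the ideal with one cell fewer.\<close>

lemma mult_ideal_diff:
  assumes "up_closed G" "l \<in> G" "up_closed (G - {l})"
    and g: "\<And>v. v \<in> Delta l \<Longrightarrow> act g l v = 0" and "z \<in> ideal G"
  shows "g * z \<in> ideal (G - {l})"
  using assms(5)
proof (induction rule: ideal_induct)
  case (basis k m s t)
  have "g * c m s t \<in> ideal (G - {l})"
  proof (cases "m = l")
    case False
    then have "c m s t \<in> ideal (G - {l})" using basis by (auto simp: ideal_def coef_c)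
    then show ?thesis using assms(3) by (simp add: ideal_mult_left)
  next
    case True
    have "c m s t \<in> ideal G" using basis by (auto simp: ideal_def coef_c)
    then have *: "g * c m s t \<in> ideal G" using assms(1) by (simp add: ideal_mult_left)
    have "R g l x s = 0" if "x \<in> T l" for x
      using act_unit[of l s x g] g[OF unit_in_Delta, of s] basis that True by simp
    with * show ?thesis
      using basis True unfolding ideal_def by (auto simp: coef_mult_same)
  qed
  then show ?case by (simp add: scale_mult_right ideal_scale)
qed (auto simp: ideal_zero distrib_left ideal_add)

lemma mult_ideal_diff_right:
  assumes "up_closed G" "l \<in> G" "up_closed (G - {l})"
    and g: "\<And>v. v \<in> Delta l \<Longrightarrow> act (star g) l v = 0" and z: "z \<in> ideal G"
  shows "z * g \<in> ideal (G - {l})"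
  using ideal_star[OF mult_ideal_diff[OF assms(1-3) g ideal_star[OF z]]] by (simp add: star_mult)

text \<open>A generalised inverse of the Gram matrix gives an element of the cell ideal
  acting as the identity on \<open>L(l)\<close>.\<close>

lemma ex_identity_on_head:
  assumes l: "l \<in> Lam" "l \<in> G"
  shows "\<exists>q\<in>ideal G. \<forall>v\<in>Delta l. act q l v - v \<in> Rad l"
proof -
  define gram where "gram v = (\<lambda>s. if s \<in> T l then pairing l s v else 0)" for v
  have "Vector_Spaces.linear fscale fscale gram"
    unfolding Vector_Spaces.linear_iff
    by (auto intro: fs.vector_space_axioms simp: gram_def pairing_add pairing_fscale fun_eq_iff)
  \<comment> \<open>The Gram matrix may be singular; \<open>p\<close> inverts it only on its
    range.\<close>
  from fp.linear_exists_right_inverse_on[OF this fs.subspace_UNIV]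
  obtain p where lin: "Vector_Spaces.linear fscale fscale p"
    and p: "\<And>v. gram (p (gram v)) = gram v" by auto
  interpret p: Vector_Spaces.linear fscale fscale p by (rule lin)
  \<comment> \<open>The coefficients of \<open>q\<close> are the matrix entries of \<open>p\<close>,
    so that \<open>q\<close> acts as \<open>p\<close> composed with \<open>gram\<close>.\<close>
  define q where "q = (\<Sum>x\<in>T l. \<Sum>y\<in>T l. sc (p (unit y) x) (c l x y))"
  have "q \<in> ideal G"
    unfolding q_def by (intro vs.subspace_sum[OF ideal_subspace] ideal_scale)
      (use l in \<open>auto simp: ideal_def coef_c\<close>)
  moreover have "act q l v - v \<in> Rad l" if v: "v \<in> Delta l" for v
  proof -
    have gram: "gram v = (\<Sum>y\<in>T l. fscale (pairing l y v) (unit y))"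
    proof
      fix u
      have "(\<Sum>y\<in>T l. fscale (pairing l y v) (unit y)) u = (\<Sum>y\<in>T l. pairing l y v * unit y u)"
        using finite_T[OF l(1)] by (induction rule: finite_induct) auto
      also have "\<dots> = gram v u"
        using finite_T[OF l(1)]
        by (simp add: gram_def unit_def if_distrib[of "\<lambda>x. _ * x"] cong: if_cong)
      finally show "gram v u = (\<Sum>y\<in>T l. fscale (pairing l y v) (unit y)) u" ..
    qed
    have sumap: "(\<Sum>y\<in>A. F y) u = (\<Sum>y\<in>A. F y u)" for A :: "'t set" and F :: "'t \<Rightarrow> 't \<Rightarrow> 'k" and u
      by (induction A rule: infinite_finite_induct) auto
    have "act q l v u = p (gram v) u" if u: "u \<in> T l" for u
    proof -
      have "act q l v u = (\<Sum>x\<in>T l. \<Sum>y\<in>T l. p (unit y) x * (pairing l y v * unit x u))"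
        using l by (simp add: q_def act_sum_left act_scale_left act_c sumap mult.assoc)
      also have "\<dots> = (\<Sum>x\<in>T l. if x = u then \<Sum>y\<in>T l. p (unit y) u * pairing l y v else 0)"
        by (intro sum.cong refl) (auto simp: unit_def)
      also have "\<dots> = (\<Sum>y\<in>T l. p (unit y) u * pairing l y v)"
        using finite_T[OF l(1)] u by simp
      also have "\<dots> = p (gram v) u"
        by (simp add: gram p.sum p.scale sumap mult.commute)
      finally show ?thesis .
    qed
    \<comment> \<open>The vector \<open>p (gram v)\<close> may have entries outside
      \<open>T l\<close>; \<open>pairing\<close> does not see them.\<close>
    then have "pairing l s (act q l v) = pairing l s (p (gram v))" for s by (simp add: pairing_def)
    moreover have "pairing l s (p (gram v)) = pairing l s v" if "s \<in> T l" for s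
      using fun_cong[OF p[of v], of s] that by (simp add: gram_def)
    ultimately show ?thesis
      using l v by (simp add: Rad_iff pairing_diff fs.subspace_diff[OF Delta_subspace])
  qed
  ultimately show ?thesis by blast
qed

section \<open>Central characters\<close>

abbreviation Lam_0 where "Lam_0 \<equiv> Lam0 sc Lam le T c"

lemma ex_notin_Rad:
  assumes "l \<in> Lam_0"
  shows "\<exists>v\<in>Delta l. v \<notin> Rad l"
proof -
  obtain s t where "l \<in> Lam" "s \<in> T l" "t \<in> T l" "phi l s t \<noteq> 0"
    using assms by (auto simp: Lam0_def)
  then have "unit t \<in> Delta l" "unit t \<notin> Rad l" by (auto simp: Rad_iff pairing_unit unit_in_Delta)
  then show ?thesis by blast
qed

text \<open>Since \<open>phi l s t\<close> is nonzero, \<open>c l u s\<close> sends the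
  \<open>t\<close>-th basis vector to a nonzero multiple of the \<open>u\<close>-th one. Commuting
  \<open>z\<close> past \<open>c l u s\<close> shows that every basis vector is an eigenvector, with
  an eigenvalue that does not depend on \<open>u\<close>.\<close>

lemma ex_central_scalar:
  assumes l0: "l \<in> Lam_0" and z: "central z"
  shows "\<exists>k. \<forall>v\<in>Delta l. act z l v = fscale k v"
proof -
  from l0 have l: "l \<in> Lam" by (simp add: Lam0_def)
  from l0 obtain s t where st: "s \<in> T l" "t \<in> T l" "phi l s t \<noteq> 0" by (auto simp: Lam0_def)
  define k where "k = pairing l s (act z l (unit t)) / phi l s t"
  have unit: "act z l (unit u) = fscale k (unit u)" if u: "u \<in> T l" for u
  proof -
    have "act (z * c l u s) l (unit t) = act (c l u s * z) l (unit t)"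
      using z by (simp add: central_def)
    then have "fscale (phi l s t) (act z l (unit u)) = fscale (pairing l s (act z l (unit t))) (unit u)"
      using l st u by (simp add: act_mult act_c act_fscale pairing_unit)
    then have "phi l s t * act z l (unit u) x = pairing l s (act z l (unit t)) * unit u x" for x
      by (metis fscale_apply)
    then show ?thesis using st(3) by (auto simp: fun_eq_iff k_def field_simps)
  qed
  have "act z l v = fscale k v" if v: "v \<in> Delta l" for v
  proof
    fix u
    show "act z l v u = fscale k v u"
    proof (cases "u \<in> T l")
      case True
      have "R z l u x = (if x = u then k else 0)" if "x \<in> T l" for x
        using act_unit[OF l that True, of z] unit[OF that] by (auto simp: unit_def split: if_splits)
      then show ?thesis
        using True finite_T[OF l] by (simp add: act_apply if_distrib[of "\<lambda>x. x * _"] cong: if_cong)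
    qed (use v in \<open>simp add: act_apply cell_mod_def\<close>)
  qed
  then show ?thesis by blast
qed

text \<open>Meaningful only for central \<open>z\<close> and \<open>l \<in> \<Lambda>\<^sup>0\<close>.\<close>

definition central_char :: "'a \<Rightarrow> 'l \<Rightarrow> 'k" where
  "central_char z l = (SOME k. \<forall>v\<in>Delta l. act z l v = fscale k v)"

lemma act_central: "l \<in> Lam_0 \<Longrightarrow> central z \<Longrightarrow> v \<in> Delta l \<Longrightarrow> act z l v = fscale (central_char z l) v"
  unfolding central_char_def using someI_ex[OF ex_central_scalar] by blast

text \<open>The simple head is nonzero for labels in \<open>Lam_0\<close>, so the scalar can be read
  off modulo the radical.\<close>

lemma central_char_eqI:
  assumes "l \<in> Lam_0" "central z" "\<And>v. v \<in> Delta l \<Longrightarrow> act z l v - fscale k v \<in> Rad l"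
  shows "central_char z l = k"
proof (rule ccontr)
  assume ne: "central_char z l \<noteq> k"
  have l: "l \<in> Lam" using assms by (simp add: Lam0_def)
  obtain v where v: "v \<in> Delta l" "v \<notin> Rad l" using ex_notin_Rad assms by blast
  have "fscale (central_char z l - k) v \<in> Rad l"
    using assms(3)[OF v(1)] act_central[OF assms(1,2) v(1)] by (simp add: fs.scale_left_diff_distrib)
  then have "fscale (inverse (central_char z l - k)) (fscale (central_char z l - k) v) \<in> Rad l"
    by (rule fs.subspace_scale[OF Rad_subspace[OF l]])
  then show False using ne v by simp
qed

lemma in_block_iff:
  assumes "l \<in> Lam_0" "central z"
  shows "in_block sc Lam le T c z l \<longleftrightarrow> central_char z l = 1"
proof
  assume "in_block sc Lam le T c z l"
  then show "central_char z l = 1"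
    by (intro central_char_eqI assms) (simp add: in_block_def fun_diff_def)
next
  assume "central_char z l = 1"
  moreover have "l \<in> Lam" using assms by (simp add: Lam0_def)
  ultimately show "in_block sc Lam le T c z l"
    using fs.subspace_0[OF Rad_subspace, of l]
    by (simp add: in_block_def act_central[OF assms] zero_fun_def)
qed

lemma central_char_mult:
  assumes "l \<in> Lam_0" "central z" "central w"
  shows "central_char (z * w) l = central_char z l * central_char w l"
proof (rule central_char_eqI[OF assms(1)])
  have l: "l \<in> Lam" using assms by (simp add: Lam0_def)
  show "central (z * w)" using assms(2,3) unfolding central_def by (metis mult.assoc)
  show "act (z * w) l v - fscale (central_char z l * central_char w l) v \<in> Rad l" if "v \<in> Delta l" for v
    using that l assms fs.subspace_0[OF Rad_subspace[OF l]]
    by (simp add: act_mult act_central act_fscale mult.commute)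
qed

lemma central_char_add:
  assumes "l \<in> Lam_0" "central z" "central w"
  shows "central_char (z + w) l = central_char z l + central_char w l"
proof (rule central_char_eqI[OF assms(1)])
  have l: "l \<in> Lam" using assms by (simp add: Lam0_def)
  show "central (z + w)" using assms(2,3) unfolding central_def by (metis distrib_left distrib_right)
  show "act (z + w) l v - fscale (central_char z l + central_char w l) v \<in> Rad l" if "v \<in> Delta l" for v
    using that l assms fs.subspace_0[OF Rad_subspace[OF l]]
    by (simp add: act_add_left act_central fs.scale_left_distrib)
qed

lemma central_char_zero: "l \<in> Lam_0 \<Longrightarrow> central_char 0 l = 0"
  by (rule central_char_eqI) (auto simp: central_def Lam0_def act_zero_left intro: fs.subspace_0[OF Rad_subspace])

lemma central_char_one: "l \<in> Lam_0 \<Longrightarrow> central_char 1 l = 1"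
  by (rule central_char_eqI) (auto simp: central_def Lam0_def act_one intro: fs.subspace_0[OF Rad_subspace])

text \<open>If \<open>b\<close> is not primitive, split it into two orthogonal central idempotents.
  Their characters at \<open>l\<close> are idempotent scalars with sum 1, so one of the two pieces
  has character 1. The descent is on the dimension of the ideal \<open>b A\<close>, written as the
  fixed space of \<open>b\<close>.\<close>

lemma ex_primitive_below:
  assumes "l \<in> Lam_0" "central b" "b * b = b" "central_char b l = 1"
  shows "\<exists>b'. primitive_central_idem b' \<and> central_char b' l = 1"
  using assms(2-4)
proof (induction "vs.dim {x. b * x = x}" arbitrary: b rule: less_induct)
  case less
  have descend: ?case if *: "central b1" "central b2" "b1 * b1 = b1" "b2 * b2 = b2" "b1 * b2 = 0"
      "b2 * b1 = 0" "b = b1 + b2" "b2 \<noteq> 0" "central_char b1 l = 1" for b1 b2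
  proof (rule less.hyps[OF _ *(1,3,9)])
    have sub: "vs.subspace {x. a * x = x}" for a
      by (auto simp: vs.subspace_def distrib_left scale_mult_right)
    have "x \<in> {x. b * x = x}" if "b1 * x = x" for x
    proof -
      have "b2 * x = b2 * (b1 * x)" using that by simp
      then have "b2 * x = 0" using *(6) by (simp flip: mult.assoc)
      then show ?thesis using that *(7) by (simp add: distrib_right)
    qed
    \<comment> \<open>The inclusion of fixed spaces is strict because \<open>b2\<close> is nonzero,
      fixed by \<open>b\<close> and killed by \<open>b1\<close>.\<close>
    moreover have "b2 \<in> {x. b * x = x}" "b2 \<notin> {x. b1 * x = x}"
      using * by (auto simp: distrib_right)
    ultimately have "{x. b1 * x = x} \<subset> {x. b * x = x}" by blast
    then show "vs.dim {x. b1 * x = x} < vs.dim {x. b * x = x}"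
      by (rule vs.dim_psubset_of_finite_span[OF sub sub _ _ finite_basis]) (simp add: span_basis)
  qed
  show ?case
  proof (cases "primitive_central_idem b")
    case False
    have "b \<noteq> 0" using less.prems central_char_zero[OF assms(1)] by auto
    have "\<exists>b1 b2. central b1 \<and> central b2 \<and> b1 * b1 = b1 \<and> b2 * b2 = b2 \<and> b1 * b2 = 0 \<and>
        b = b1 + b2 \<and> b1 \<noteq> 0 \<and> b2 \<noteq> 0"
      using False unfolding primitive_central_idem_def
      by (simp only: less.prems(1,2) \<open>b \<noteq> 0\<close> simp_thms not_all not_imp de_Morgan_disj) metis
    then obtain b1 b2 where b: "central b1" "central b2" "b1 * b1 = b1" "b2 * b2 = b2"
      "b1 * b2 = 0" "b = b1 + b2" "b1 \<noteq> 0" "b2 \<noteq> 0"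
      by blast
    have "b2 * b1 = 0" using b(1,5) unfolding central_def by metis
    have "central_char b1 l * central_char b1 l = central_char b1 l" using central_char_mult[OF assms(1) b(1) b(1)] b(3) by simp
    then have "central_char b1 l = 0 \<or> central_char b1 l = 1" by simp
    moreover have "central_char b1 l + central_char b2 l = 1" using central_char_add[OF assms(1) b(1,2)] b(6) less.prems by simp
    ultimately consider "central_char b1 l = 1" | "central_char b2 l = 1" by auto
    then show ?thesis
    proof cases
      case 1
      then show ?thesis using descend[OF b(1-5) \<open>b2 * b1 = 0\<close> b(6,8)] by blast
    next
      case 2
      then show ?thesis
        using descend[OF b(2,1,4,3) \<open>b2 * b1 = 0\<close> b(5) _ b(7)] b(6) by (simp add: add.commute)
    qed
  qed (use less.prems in blast)
qed

lemma ex_block: "l \<in> Lam_0 \<Longrightarrow> \<exists>b. primitive_central_idem b \<and> central_char b l = 1"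
  using ex_primitive_below[of l 1] central_char_one[of l] by (simp add: central_def)

end

section \<open>Composition series\<close>

lemma is_submod_iff:
  "is_submod sc Lam le T c B l M \<longleftrightarrow>
     M \<subseteq> cell_mod T l \<and> fs.subspace M \<and> (\<forall>a\<in>B. \<forall>x\<in>M. cell_act sc Lam le T c a l x \<in> M)"
  unfolding is_submod_def fs.subspace_def
  by (auto simp: plus_fun_def fscale_def zero_fun_def)

lemma cell_mod_finite_span:
  fixes T :: "'l \<Rightarrow> 't set"
  assumes "finite (T l)"
  shows "(cell_mod T l :: ('t \<Rightarrow> 'k::field) set) \<subseteq> fs.span (unit ` T l)"
proof
  fix v :: "'t \<Rightarrow> 'k" assume v: "v \<in> cell_mod T l"
  have sum_apply: "(\<Sum>s\<in>A. F s) u = (\<Sum>s\<in>A. F s u)"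
    for A :: "'t set" and F :: "'t \<Rightarrow> 't \<Rightarrow> 'k" and u
    by (induction A rule: infinite_finite_induct) auto
  have "v = (\<Sum>s\<in>T l. fscale (v s) (unit s))"
    using v assms
    by (auto simp: fun_eq_iff sum_apply unit_def cell_mod_def if_distrib[of "\<lambda>x. _ * x"] cong: if_cong)
  also have "\<dots> \<in> fs.span (unit ` T l)"
    by (intro fs.span_sum fs.span_scale fs.span_base) auto
  finally show "v \<in> fs.span (unit ` T l)" .
qed

text \<open>Induction on dimension, appending each module to a series of one of its maximal
  submodules. It ensures that the \<open>SOME\<close> in \<open>decomp_num\<close> picks a genuine
  composition series.\<close>

lemma ex_comp_series:
  assumes fin: "finite (T l)"
  shows "\<exists>Ms. comp_series sc Lam le T c B l Ms"
proof -
  let ?sub = "is_submod sc Lam le T c B l"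
  let ?series = "\<lambda>Ms N. Ms \<noteq> [] \<and> hd Ms = {\<lambda>_. 0} \<and> last Ms = N \<and>
     (\<forall>k<length Ms. ?sub (Ms ! k)) \<and>
     (\<forall>k. Suc k < length Ms \<longrightarrow>
        Ms ! k \<subset> Ms ! Suc k \<and> \<not> (\<exists>N. ?sub N \<and> Ms ! k \<subset> N \<and> N \<subset> Ms ! Suc k))"
  have dim_less: "fs.dim N < fs.dim N'" if "?sub N" "?sub N'" "N \<subset> N'" for N N'
    using that cell_mod_finite_span[of T l] fin unfolding is_submod_iff
    by (intro fs.dim_psubset_of_finite_span[where F="unit ` T l"]) auto
  have zero_act: "cell_act sc Lam le T c a l 0 = 0" for a
    by (auto simp: cell_act_def fun_eq_iff)
  have sub0: "?sub {0}"
    unfolding is_submod_iff by (auto simp: zero_act cell_mod_def intro: fs.subspace_single_0)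
  have "\<exists>Ms. ?series Ms N" if "?sub N" for N
    using that
  proof (induction "fs.dim N" arbitrary: N rule: less_induct)
    case less
    show ?case
    proof (cases "N = {0}")
      case True
      then have "?series [N] N" using less.prems by (simp add: zero_fun_def)
      then show ?thesis by (rule exI)
    next
      case False
      have "0 \<in> N" using less.prems fs.subspace_0 by (auto simp: is_submod_iff)
      with False have "?sub {0} \<and> {0} \<subset> N" using sub0 by auto
      \<comment> \<open>A proper submodule of greatest dimension is maximal.\<close>
      moreover have "\<forall>y. ?sub y \<and> y \<subset> N \<longrightarrow> fs.dim y < fs.dim N"
        using dim_less less.prems by blast
      ultimately obtain N' where N': "?sub N'" "N' \<subset> N"
        "\<And>y. ?sub y \<Longrightarrow> y \<subset> N \<Longrightarrow> fs.dim y \<le> fs.dim N'"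
        using ex_has_greatest_nat[of "\<lambda>y. ?sub y \<and> y \<subset> N" "{0}" fs.dim "fs.dim N"] by blast
      obtain Ms where Ms: "?series Ms N'"
        using less.hyps[OF dim_less[OF N'(1) less.prems N'(2)] N'(1)] by (elim exE)
      have max: "\<not> (\<exists>X. ?sub X \<and> N' \<subset> X \<and> X \<subset> N)"
        using N' dim_less by (meson leD)
      have sub: "?sub ((Ms @ [N]) ! k)" if "k < length (Ms @ [N])" for k
      proof (cases "k < length Ms")
        case True
        then show ?thesis using Ms by (simp add: nth_append)
      next
        case False
        then have "k = length Ms" using that by simp
        then show ?thesis using less.prems by simp
      qed
      have step: "(Ms @ [N]) ! k \<subset> (Ms @ [N]) ! Suc k \<and>
          \<not> (\<exists>X. ?sub X \<and> (Ms @ [N]) ! k \<subset> X \<and> X \<subset> (Ms @ [N]) ! Suc k)"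
        if k: "Suc k < length (Ms @ [N])" for k
      proof (cases "Suc k < length Ms")
        case True
        then show ?thesis using Ms by (simp add: nth_append)
      next
        case False
        \<comment> \<open>The only new step is the one from \<open>last Ms\<close> to the appended
          module.\<close>
        with k have "Suc k = length Ms" by simp
        moreover from this have "(Ms @ [N]) ! k = last Ms"
          by (metis Ms diff_Suc_1 last_conv_nth lessI nth_append)
        ultimately have "(Ms @ [N]) ! k = N'" "(Ms @ [N]) ! Suc k = N" using Ms by simp_all
        then show ?thesis using max N'(2) by simp
      qed
      have "?series (Ms @ [N]) N"
      proof (intro conjI)
        show "hd (Ms @ [N]) = {\<lambda>_. 0}" using Ms by simp
      qed (simp, simp, intro allI impI sub, assumption, intro allI impI step, assumption)
      then show ?thesis by (rule exI)
    qed
  qed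
  moreover have "?sub (cell_mod T l)"
    unfolding is_submod_iff
    using Delta_subspace[of T l] by (simp add: cell_act_def) (simp add: cell_mod_def)
  ultimately show ?thesis unfolding comp_series_def by simp
qed

section \<open>Corner algebras\<close>

locale cellular_decomp = cellular sc Lam le T c star
  for sc :: "'k::field \<Rightarrow> 'a::ring_1 \<Rightarrow> 'a"
    and Lam :: "'l set" and le :: "'l \<Rightarrow> 'l \<Rightarrow> bool"
    and T :: "'l \<Rightarrow> 't set" and c :: "'l \<Rightarrow> 't \<Rightarrow> 't \<Rightarrow> 'a"
    and star :: "'a \<Rightarrow> 'a" +
  fixes I :: "'i set" and e :: "'i \<Rightarrow> 'a"
  assumes decomp: "idempotent_decomp star Lam T c I e"
begin

abbreviation Ti where "Ti \<equiv> T_idx e T c"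
abbreviation Li where "Li \<equiv> Lam_idx e Lam T c"
abbreviation V :: "'i \<Rightarrow> 'l \<Rightarrow> ('t \<Rightarrow> 'k) set" where "V i \<equiv> cell_mod (Ti i)"

lemma sum_e: "(\<Sum>i\<in>I. e i) = 1"
  and e_idem: "i \<in> I \<Longrightarrow> e i * e i = e i"
  and e_orth: "i \<in> I \<Longrightarrow> j \<in> I \<Longrightarrow> i \<noteq> j \<Longrightarrow> e i * e j = 0"
  and e_cover: "l \<in> Lam \<Longrightarrow> t \<in> T l \<Longrightarrow> \<exists>i\<in>I. \<forall>s\<in>T l. e i * c l t s = c l t s"
  and star_e: "i \<in> I \<Longrightarrow> star (e i) = e i"
  using decomp by (auto simp: idempotent_decomp_def)

lemma Ti_subset: "Ti i l \<subseteq> T l"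
  and Li_subset: "Li i \<subseteq> Lam"
  by (auto simp: T_idx_def Lam_idx_def)

lemma Ti_D: "s \<in> Ti i l \<Longrightarrow> s \<in> T l"
  and Li_D: "l \<in> Li i \<Longrightarrow> l \<in> Lam"
  using Ti_subset Li_subset by blast+

lemma ex_Li: "l \<in> Lam \<Longrightarrow> \<exists>i\<in>I. l \<in> Li i"
  using e_cover T_nonempty unfolding Lam_idx_def T_idx_def by blast

text \<open>Every row index is fixed by some idempotent, and orthogonality forces the others to kill
  it. So each \<open>e i\<close> is diagonal, with entries 0 and 1, in the cellular basis.\<close>

lemma e_c:
  assumes "i \<in> I" "l \<in> Lam" "s \<in> T l" "t \<in> T l"
  shows "e i * c l s t = (if s \<in> Ti i l then c l s t else 0)"
proof (cases "s \<in> Ti i l")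
  case False
  obtain j where j: "j \<in> I" "\<forall>t\<in>T l. e j * c l s t = c l s t" using e_cover assms by blast
  with False assms have "i \<noteq> j" by (auto simp: T_idx_def)
  then have "e i * (e j * c l s t) = 0" using e_orth[of i j] assms(1) j(1) by (simp flip: mult.assoc)
  then show ?thesis using j assms False by simp
qed (use assms in \<open>simp add: T_idx_def\<close>)

lemma c_e:
  assumes "i \<in> I" "l \<in> Lam" "s \<in> T l" "t \<in> T l"
  shows "c l s t * e i = (if t \<in> Ti i l then c l s t else 0)"
proof -
  have "c l s t * e i = star (e i * c l t s)" using assms by (simp add: star_mult star_c star_e)
  then show ?thesis using assms by (simp add: e_c star_c)
qed

lemma coef_e_mult:
  assumes "i \<in> I" "l \<in> Lam" "s \<in> T l" "t \<in> T l"
  shows "coef l s t (e i * a) = (if s \<in> Ti i l then coef l s t a else 0)"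
  by (rule support_induct[where Q="\<lambda>_ _ _. True" and a=a])
    (use assms in \<open>auto simp: distrib_left scale_mult_right e_c coef_c\<close>)

lemma coef_mult_e:
  assumes "i \<in> I" "l \<in> Lam" "s \<in> T l" "t \<in> T l"
  shows "coef l s t (a * e i) = (if t \<in> Ti i l then coef l s t a else 0)"
  by (rule support_induct[where Q="\<lambda>_ _ _. True" and a=a])
    (use assms in \<open>auto simp: distrib_right scale_mult_left c_e coef_c\<close>)

lemma corner_iff: "i \<in> I \<Longrightarrow> a \<in> corner e i \<longleftrightarrow> e i * a = a \<and> a * e i = a"
  unfolding corner_def using e_idem[of i] by (auto simp: mult.assoc) (metis mult.assoc)+

lemma c_corner: "i \<in> I \<Longrightarrow> l \<in> Lam \<Longrightarrow> s \<in> Ti i l \<Longrightarrow> t \<in> Ti i l \<Longrightarrow> c l s t \<in> corner e i"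
  by (simp add: corner_iff e_c c_e Ti_D)

lemma corner_coef_zero:
  assumes "i \<in> I" "a \<in> corner e i" "l \<in> Lam" "s \<in> T l" "t \<in> T l" "\<not> (s \<in> Ti i l \<and> t \<in> Ti i l)"
  shows "coef l s t a = 0"
  using assms coef_e_mult[of i l s t a] coef_mult_e[of i l s t a] by (auto simp: corner_iff)

lemma corner_mult: "i \<in> I \<Longrightarrow> a \<in> corner e i \<Longrightarrow> b \<in> corner e i \<Longrightarrow> a * b \<in> corner e i"
  by (simp add: corner_iff mult.assoc) (metis mult.assoc)

lemma R_corner_zero:
  assumes "i \<in> I" "a \<in> corner e i" "l \<in> Lam" "s \<in> T l" "u \<in> T l" "u \<notin> Ti i l"
  shows "R a l u s = 0"
proof -
  have "R a l u s = coef l u s (e i * (a * c l s s))"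
    using assms by (simp add: R_eq_coef corner_iff flip: mult.assoc)
  then show ?thesis using assms by (simp add: coef_e_mult)
qed

text \<open>Inserting \<open>e i\<close> between \<open>c l s s\<close> and \<open>c l t t\<close>
  changes nothing on the left and kills the right factor. Hence the subspace \<open>V i l\<close> is
  orthogonal to all remaining coordinate vectors.\<close>

lemma phi_cross:
  assumes "i \<in> I" "l \<in> Lam" "s \<in> Ti i l" "t \<in> T l" "t \<notin> Ti i l"
  shows "phi l s t = 0" "phi l t s = 0"
proof -
  have s: "s \<in> T l" using assms Ti_D by blast
  have "c l s s * c l t t = c l s s * (e i * c l t t)"
    using c_e[of i l s s] assms s by (simp flip: mult.assoc)
  then have "c l s s * c l t t = 0" using assms by (simp add: e_c)
  then show "phi l s t = 0" using assms s phi_eq[of l s t s] by (simp add: R_eq_coef)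
  then show "phi l t s = 0" using assms s phi_sym by metis
qed

lemma V_subset: "V i l \<subseteq> Delta l"
  using Ti_subset by (fastforce simp: cell_mod_def)

lemma V_D: "v \<in> V i l \<Longrightarrow> v \<in> Delta l"
  using V_subset by blast

lemma act_corner_in_V:
  assumes "i \<in> I" "l \<in> Lam" "a \<in> corner e i"
  shows "act a l v \<in> V i l"
  using assms by (auto simp: cell_mod_def act_apply R_corner_zero)

lemma e_corner: "i \<in> I \<Longrightarrow> e i \<in> corner e i"
  by (simp add: corner_iff e_idem)

lemma act_e:
  assumes "i \<in> I" "l \<in> Lam" "v \<in> V i l"
  shows "act (e i) l v = v"
proof
  fix u
  have "R (e i) l u s * v s = R 1 l u s * v s" if "s \<in> T l" "u \<in> T l" for s
    using assms that by (cases "s \<in> Ti i l") (auto simp: R_eq_coef e_c cell_mod_def)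
  then have "act (e i) l v u = act 1 l v u"
    unfolding act_apply by (auto intro!: sum.cong)
  then show "act (e i) l v u = v u" using assms by (simp add: act_one V_D)
qed

text \<open>The structure constants of the full algebra satisfy the rule that defines those of the
  corner, and a coordinate at \<open>l\<close> shows that any solution agrees with them on
  \<open>Ti i l\<close>.\<close>

lemma cell_coeff_corner:
  assumes "i \<in> I" "l \<in> Lam" "s \<in> Ti i l" "u \<in> Ti i l" "a \<in> corner e i"
  shows "cell_coeff sc (Li i) le (Ti i) c a l u s = R a l u s"
proof -
  let ?P = "\<lambda>r. \<forall>t\<in>Ti i l. a * c l s t - (\<Sum>w\<in>Ti i l. sc (r w) (c l w t))
    \<in> above sc (Li i) le (Ti i) c l"
  note ai = above_iff[OF Li_subset[of i] Ti_subset[of i]]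
  have fin: "finite (Ti i l)" using finite_T[OF assms(2)] Ti_subset finite_subset by blast
  have coef: "coef m x y (a * c l s t - (\<Sum>w\<in>Ti i l. sc (r w) (c l w t))) =
    coef m x y (a * c l s t) - (if m = l \<and> x \<in> Ti i l \<and> y = t then r x else 0)"
    if "m \<in> Lam" "x \<in> T m" "y \<in> T m" "t \<in> Ti i l" for m x y t r
  proof -
    have "(\<Sum>w\<in>Ti i l. r w * coef m x y (c l w t)) =
      (\<Sum>w\<in>Ti i l. if w = x then (if m = l \<and> y = t then r x else 0) else 0)"
      by (rule sum.cong) (use that assms in \<open>auto simp: coef_c Ti_D\<close>)
    then show ?thesis using fin by (auto simp: sum.delta)
  qed
  have "?P (\<lambda>w. R a l w s)"
  proof
    fix t assume t: "t \<in> Ti i l"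
    show "a * c l s t - (\<Sum>w\<in>Ti i l. sc (R a l w s) (c l w t)) \<in> above sc (Li i) le (Ti i) c l"
      unfolding ai
    proof (intro ballI impI)
      fix m x y assume m: "m \<in> Lam" "x \<in> T m" "y \<in> T m"
        "\<not> (m \<in> Li i \<and> le l m \<and> m \<noteq> l \<and> x \<in> Ti i m \<and> y \<in> Ti i m)"
      have "a * c l s t \<in> corner e i" using assms t by (simp add: corner_mult c_corner)
      then have "coef m x y (a * c l s t) = 0" if "\<not> (x \<in> Ti i m \<and> y \<in> Ti i m)"
        using corner_coef_zero that m assms by blast
      moreover have "coef m x y (a * c l s t) = 0" if "\<not> le l m"
        using that m assms t by (simp add: coef_mult_zero Ti_D)
      moreover have "m \<in> Li i" if "x \<in> Ti i m" using that m by (auto simp: Lam_idx_def)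
      ultimately show "coef m x y (a * c l s t - (\<Sum>w\<in>Ti i l. sc (R a l w s) (c l w t))) = 0"
        unfolding coef[OF m(1-3) t]
        using m t assms by (cases "m = l") (auto simp: coef_mult_same Ti_D R_corner_zero)
    qed
  qed
  then have "?P (SOME r. ?P r)" by (rule someI[where P="?P"])
  then have "a * c l s s - (\<Sum>w\<in>Ti i l. sc ((SOME r. ?P r) w) (c l w s))
    \<in> above sc (Li i) le (Ti i) c l" using assms by blast
  then have "coef l u s (a * c l s s - (\<Sum>w\<in>Ti i l. sc ((SOME r. ?P r) w) (c l w s))) = 0"
    unfolding ai using assms Ti_D by blast
  then have "(SOME r. ?P r) u = R a l u s"
    unfolding coef[OF assms(2) Ti_D[OF assms(4)] Ti_D[OF assms(3)] assms(3)]
    using assms by (simp add: Ti_D coef_mult_same)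
  then show ?thesis by (simp only: cell_coeff_def)
qed

lemma form_coeff_corner:
  assumes "i \<in> I" "l \<in> Lam" "s \<in> Ti i l" "t \<in> Ti i l"
  shows "form_coeff sc (Li i) le (Ti i) c l s t = phi l s t"
proof -
  let ?P = "\<lambda>p. \<forall>u\<in>Ti i l. \<forall>b\<in>Ti i l. c l u s * c l t b - sc p (c l u b)
    \<in> above sc (Li i) le (Ti i) c l"
  note ai = above_iff[OF Li_subset[of i] Ti_subset[of i]]
  have "?P (phi l s t)"
  proof (intro ballI)
    fix u b assume ub: "u \<in> Ti i l" "b \<in> Ti i l"
    show "c l u s * c l t b - sc (phi l s t) (c l u b) \<in> above sc (Li i) le (Ti i) c l"
      unfolding ai
    proof (intro ballI impI)
      fix m x y assume m: "m \<in> Lam" "x \<in> T m" "y \<in> T m"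
        "\<not> (m \<in> Li i \<and> le l m \<and> m \<noteq> l \<and> x \<in> Ti i m \<and> y \<in> Ti i m)"
      have "c l u s * c l t b \<in> corner e i" using assms ub by (simp add: corner_mult c_corner)
      then have "coef m x y (c l u s * c l t b) = 0" if "\<not> (x \<in> Ti i m \<and> y \<in> Ti i m)"
        using corner_coef_zero that m assms by blast
      moreover have "coef m x y (c l u s * c l t b) = 0" if "\<not> le l m"
        using that m assms ub by (simp add: coef_mult_zero Ti_D)
      moreover have "m \<in> Li i" if "x \<in> Ti i m" using that m by (auto simp: Lam_idx_def)
      ultimately show "coef m x y (c l u s * c l t b - sc (phi l s t) (c l u b)) = 0"
        using m ub assms
        by (cases "m = l") (auto simp: coef_c coef_mult_same Ti_D R_c_same)
    qed
  qed
  then have "?P (SOME p. ?P p)" by (rule someI[where P="?P"])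
  then have "c l s s * c l t s - sc (SOME p. ?P p) (c l s s) \<in> above sc (Li i) le (Ti i) c l"
    using assms by blast
  then have "coef l s s (c l s s * c l t s - sc (SOME p. ?P p) (c l s s)) = 0"
    unfolding ai using assms Ti_D by blast
  then have "(SOME p. ?P p) = phi l s t"
    using assms by (simp add: Ti_D coef_mult_same coef_c R_c_same)
  then show ?thesis by (simp only: form_coeff_def)
qed

lemma sum_V:
  assumes "l \<in> Lam" "v \<in> V i l"
  shows "(\<Sum>s\<in>T l. f s * v s) = (\<Sum>s\<in>Ti i l. f s * v s)"
  by (rule sum.mono_neutral_right) (use assms finite_T Ti_subset in \<open>auto simp: cell_mod_def\<close>)

lemma cell_act_corner:
  assumes "i \<in> I" "l \<in> Lam" "a \<in> corner e i" "v \<in> V i l"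
  shows "cell_act sc (Li i) le (Ti i) c a l v = act a l v"
proof
  fix u
  show "cell_act sc (Li i) le (Ti i) c a l v u = act a l v u"
    using assms act_corner_in_V[OF assms(1-3), of v]
    by (auto simp: cell_act_def[of sc "Li i"] act_apply cell_coeff_corner sum_V Ti_D)
      (auto simp: cell_mod_def act_apply sum_V[OF assms(2,4)])
qed

lemma cell_form_corner:
  assumes "i \<in> I" "l \<in> Lam" "v \<in> V i l" "w \<in> V i l"
  shows "cell_form sc (Li i) le (Ti i) c l v w = form l v w"
proof -
  have "form l v w = (\<Sum>s\<in>T l. pairing l s w * v s)" using assms by (simp add: form_eq mult.commute)
  also have "\<dots> = (\<Sum>s\<in>Ti i l. pairing l s w * v s)" using assms by (simp add: sum_V)
  also have "\<dots> = cell_form sc (Li i) le (Ti i) c l v w"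
    unfolding pairing_def sum_V[OF assms(2,4)]
    using assms by (simp add: cell_form_def form_coeff_corner sum_distrib_left mult_ac)
  finally show ?thesis ..
qed

lemma pairing_cross:
  assumes "i \<in> I" "l \<in> Lam" "s \<in> T l" "s \<notin> Ti i l" "v \<in> V i l"
  shows "pairing l s v = 0"
  unfolding pairing_def sum_V[OF assms(2,5)] using assms by (simp add: phi_cross)

text \<open>Indices outside \<open>Ti i l\<close> pair to zero with \<open>V i l\<close>, so
  orthogonality inside the corner already gives orthogonality to the whole cell module.\<close>

lemma cell_rad_corner:
  assumes "i \<in> I" "l \<in> Lam"
  shows "cell_rad sc (Li i) le (Ti i) c l = Rad l \<inter> V i l"
proof (intro set_eqI iffI)
  fix v assume v: "v \<in> cell_rad sc (Li i) le (Ti i) c l"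
  then have V: "v \<in> V i l" by (simp add: cell_rad_def)
  have "pairing l s v = 0" if s: "s \<in> T l" for s
  proof (cases "s \<in> Ti i l")
    case True
    then have u: "unit s \<in> V i l" by (auto simp: cell_mod_def unit_def)
    then have "form l v (unit s) = 0"
      using v cell_form_corner[OF assms V u] by (simp add: cell_rad_def)
    then have "(\<Sum>x\<in>T l. unit s x * pairing l x v) = 0"
      using form_sym[OF assms(2)] form_eq[OF assms(2)] by metis
    then show ?thesis
      using finite_T[OF assms(2)] s
      by (simp add: unit_def if_distrib[of "\<lambda>x. x * _"] cong: if_cong)
  qed (use assms s V in \<open>simp add: pairing_cross\<close>)
  then show "v \<in> Rad l \<inter> V i l" using V assms by (simp add: Rad_iff V_D)
next
  fix v assume "v \<in> Rad l \<inter> V i l"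
  then show "v \<in> cell_rad sc (Li i) le (Ti i) c l"
    using assms by (auto simp: cell_rad_def[of sc "Li i"] cell_form_corner)
      (auto simp: cell_rad_def V_D)
qed

lemma corner_submod_iff:
  assumes "i \<in> I" "l \<in> Lam"
  shows "is_submod sc (Li i) le (Ti i) c (corner e i) l M \<longleftrightarrow>
    M \<subseteq> V i l \<and> fs.subspace M \<and> (\<forall>a\<in>corner e i. \<forall>x\<in>M. act a l x \<in> M)"
proof (cases "M \<subseteq> V i l")
  case True
  then have "cell_act sc (Li i) le (Ti i) c a l x = act a l x" if "a \<in> corner e i" "x \<in> M" for a x
    using that cell_act_corner[OF assms] by blast
  then show ?thesis by (simp add: is_submod_iff)
qed (simp add: is_submod_iff)

end

section \<open>Maximal labels and congruence modulo a subspace\<close>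

context cellular
begin

text \<open>Minimise the number of labels above \<open>m\<close>: a strictly larger label in
  \<open>S\<close> would have fewer, since \<open>m\<close> is above itself but not above
  it.\<close>

lemma ex_maximal:
  assumes "S \<subseteq> Lam" "S \<noteq> {}"
  shows "\<exists>m\<in>S. \<forall>y\<in>S. le m y \<longrightarrow> y = m"
proof -
  let ?f = "\<lambda>m. card {n \<in> Lam. le m n}"
  obtain m where m: "m \<in> S" "\<And>y. y \<in> S \<Longrightarrow> ?f m \<le> ?f y"
    using ex_has_least_nat[of "\<lambda>m. m \<in> S" _ ?f] assms(2) by blast
  have "y = m" if y: "y \<in> S" "le m y" for y
  proof (rule ccontr)
    assume "y \<noteq> m"
    have Lam: "y \<in> Lam" "m \<in> Lam" using y m assms by auto
    have "{n \<in> Lam. le y n} \<subseteq> {n \<in> Lam. le m n}" using Lam y le_trans by blast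
    moreover have "m \<in> {n \<in> Lam. le m n}" "m \<notin> {n \<in> Lam. le y n}"
      using Lam le_refl le_antisym y \<open>y \<noteq> m\<close> by auto
    ultimately have "?f y < ?f m"
      using finite_Lam by (intro psubset_card_mono) auto
    then show False using m y by fastforce
  qed
  then show ?thesis using m by blast
qed

end

text \<open>Quotient modules are not formed as types; calculations in them are carried out as
  congruences modulo \<open>N\<close>.\<close>

lemma (in vector_space)
  assumes "subspace N"
  shows subspace_cong_trans: "x - y \<in> N \<Longrightarrow> y - z \<in> N \<Longrightarrow> x - z \<in> N"
    and subspace_cong_sym: "x - y \<in> N \<Longrightarrow> y - x \<in> N"
    and subspace_cong_mem: "x - y \<in> N \<Longrightarrow> x \<in> N \<longleftrightarrow> y \<in> N"
proof -
  show "x - z \<in> N" if "x - y \<in> N" "y - z \<in> N"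
    using subspace_add[OF assms that] by simp
  show "y - x \<in> N" if "x - y \<in> N"
    using subspace_neg[OF assms that] by simp
  show "x \<in> N \<longleftrightarrow> y \<in> N" if "x - y \<in> N"
    using subspace_add[OF assms that, of y] subspace_diff[OF assms _ that, of x] by auto
qed

section \<open>Simple factors of corner cell modules\<close>

context cellular_decomp
begin

abbreviation corner_submod where
  "corner_submod i \<equiv> is_submod sc (Li i) le (Ti i) c (corner e i)"

text \<open>A simple factor \<open>Q/N\<close> of a corner cell module is the head of \<open>V(m, i)\<close>, where \<open>m\<close> is
  maximal among the labels whose cell acts nontrivially on \<open>Q/N\<close>: since everything above \<open>m\<close> acts
  by zero, \<open>c\<^sub>u \<mapsto> c\<^sub>u\<^sub>t z\<close> is a homomorphism onto \<open>Q/N\<close>.\<close>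

lemma simple_factor:
  assumes i: "i \<in> I" and l: "l \<in> Lam"
    and N: "corner_submod i l N" and Q: "corner_submod i l Q" and NQ: "N \<subset> Q"
    and simple: "\<not> (\<exists>X. corner_submod i l X \<and> N \<subset> X \<and> X \<subset> Q)"
  shows "\<exists>m. m \<in> Lam0 sc (Li i) le (Ti i) c \<and>
    subquot_iso sc (Li i) le (Ti i) c (corner e i) l N Q m
      (cell_rad sc (Li i) le (Ti i) c m) (cell_mod (Ti i) m) \<and>
    (\<exists>s\<in>Ti i m. \<exists>t\<in>Ti i m. \<exists>z\<in>Q. act (c m s t) l z \<notin> N) \<and>
    (\<forall>a\<in>corner e i. (\<forall>v\<in>V i m. act a m v \<in> Rad m) \<longrightarrow> (\<forall>z\<in>Q. act a l z \<in> N))"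
proof -
  note sub_iff = corner_submod_iff[OF i l]
  have N_sub: "fs.subspace N" and N_V: "N \<subseteq> V i l"
    and N_act: "\<And>a x. a \<in> corner e i \<Longrightarrow> x \<in> N \<Longrightarrow> act a l x \<in> N"
    using N unfolding sub_iff by auto
  have Q_sub: "fs.subspace Q" and Q_V: "Q \<subseteq> V i l"
    and Q_act: "\<And>a x. a \<in> corner e i \<Longrightarrow> x \<in> Q \<Longrightarrow> act a l x \<in> Q"
    using Q unfolding sub_iff by auto
  note N_add = fs.subspace_add[OF N_sub] and N_scale = fs.subspace_scale[OF N_sub]
    and N_0 = fs.subspace_0[OF N_sub] and N_diff = fs.subspace_diff[OF N_sub]
    and N_trans = fs.subspace_cong_trans[OF N_sub] and N_sym = fs.subspace_cong_sym[OF N_sub]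
    and N_mem = fs.subspace_cong_mem[OF N_sub]
  note Q_add = fs.subspace_add[OF Q_sub] and Q_scale = fs.subspace_scale[OF Q_sub]
  define hits where "hits m \<longleftrightarrow> m \<in> Lam \<and>
    (\<exists>s\<in>Ti i m. \<exists>t\<in>Ti i m. \<exists>z\<in>Q. act (c m s t) l z \<notin> N)" for m
  \<comment> \<open>The idempotent \<open>e i\<close> is a combination of corner basis elements and
    acts as the identity on the nonzero quotient, so some basis element acts nontrivially.\<close>
  have "\<exists>m. hits m"
  proof (rule ccontr)
    assume no: "\<nexists>m. hits m"
    obtain w where w: "w \<in> Q" "w \<notin> N" using NQ by blast
    have "act (e i) l w \<in> N"
    proof (rule support_induct[where Q="\<lambda>l s t. s \<in> Ti i l \<and> t \<in> Ti i l"])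
      show "coef m s t (e i) = 0" if "m \<in> Lam" "s \<in> T m" "t \<in> T m" "\<not> (s \<in> Ti i m \<and> t \<in> Ti i m)"
        for m s t using corner_coef_zero[OF i e_corner[OF i] that] .
      show "act (sc k (c m s t)) l w \<in> N"
        if "m \<in> Lam" "s \<in> Ti i m \<and> t \<in> Ti i m" for k m s t
        using that no w l by (auto simp: act_scale_left hits_def intro!: N_scale)
      show "act 0 l w \<in> N" unfolding act_zero_left[OF l] by (rule N_0)
      show "act (x + y) l w \<in> N" if "act x l w \<in> N" "act y l w \<in> N" for x y
        unfolding act_add_left[OF l] using that by (rule N_add)
    qed
    then show False using w Q_V act_e[OF i l] by auto
  qed
  then obtain m where m: "hits m" and max: "\<And>y. hits y \<Longrightarrow> le m y \<Longrightarrow> y = m"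
    using ex_maximal[of "{m. hits m}"] by (auto simp: hits_def)
  have mL: "m \<in> Lam" using m by (simp add: hits_def)
  obtain s0 t z0 where s0: "s0 \<in> Ti i m" and t: "t \<in> Ti i m" and z0: "z0 \<in> Q"
    and hit: "act (c m s0 t) l z0 \<notin> N" using m by (auto simp: hits_def)
  \<comment> \<open>Maximality of \<open>m\<close>: corner elements supported strictly above
    \<open>m\<close> act as zero on the quotient.\<close>
  have kill: "act a l z \<in> N" if a: "\<And>m' x y. m' \<in> Lam \<Longrightarrow> x \<in> T m' \<Longrightarrow> y \<in> T m' \<Longrightarrow>
      \<not> (le m m' \<and> m' \<noteq> m \<and> x \<in> Ti i m' \<and> y \<in> Ti i m') \<Longrightarrow> coef m' x y a = 0" and z: "z \<in> Q" for a z
  proof (rule support_induct[where Q="\<lambda>m' x y. le m m' \<and> m' \<noteq> m \<and> x \<in> Ti i m' \<and> y \<in> Ti i m'"])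
    show "act (sc k (c m' x y)) l z \<in> N"
      if "m' \<in> Lam" "le m m' \<and> m' \<noteq> m \<and> x \<in> Ti i m' \<and> y \<in> Ti i m'" for k m' x y
    proof -
      have "act (c m' x y) l z \<in> N" using that max[of m'] z by (auto simp: hits_def)
      then show ?thesis using l by (simp add: act_scale_left N_scale)
    qed
    show "act 0 l z \<in> N" unfolding act_zero_left[OF l] by (rule N_0)
    show "act (x + y) l z \<in> N" if "act x l z \<in> N" "act y l z \<in> N" for x y
      unfolding act_add_left[OF l] using that by (rule N_add)
  qed (use a in blast)
  \<comment> \<open>\<open>C v\<close> puts the coordinates \<open>v\<close> into column
    \<open>t\<close> of the cell \<open>m\<close>; applying it to \<open>z0\<close> gives the
    homomorphism \<open>Psi\<close> from the cell module of \<open>m\<close>.\<close>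
  define C where "C v = (\<Sum>u\<in>T m. sc (v u) (c m u t))" for v
  define Psi where "Psi v = act (C v) l z0" for v
  have C_add: "C (v + w) = C v + C w" and C_scale: "C (fscale k v) = sc k (C v)"
    and C_diff: "C (v - w) = C v - C w" for v w k
    by (simp_all add: C_def vs.scale_left_distrib sum.distrib vs.scale_sum_right
        vs.scale_left_diff_distrib sum_subtractf)
  have Psi_add: "Psi (v + w) = Psi v + Psi w" and Psi_scale: "Psi (fscale k v) = fscale k (Psi v)"
    and Psi_diff: "Psi (v - w) = Psi v - Psi w" for v w k
    using l by (simp_all add: Psi_def C_add C_scale C_diff act_add_left act_scale_left act_diff_left)
  have C_unit: "C (unit s) = c m s t" if "s \<in> T m" for s
    using finite_T[OF mL] that
    by (simp add: C_def unit_def if_distrib[of "\<lambda>x. sc x _"] cong: if_cong)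
  have C_corner: "C v \<in> corner e i" if v: "v \<in> V i m" for v
  proof -
    have "e i * sc (v u) (c m u t) = sc (v u) (c m u t)" if "u \<in> T m" for u
      using v i mL t that by (cases "u \<in> Ti i m") (auto simp: scale_mult_right e_c cell_mod_def Ti_D)
    moreover have "sc (v u) (c m u t) * e i = sc (v u) (c m u t)" if "u \<in> T m" for u
      using i mL t that by (simp add: scale_mult_left c_e Ti_D)
    ultimately show ?thesis using i by (simp add: corner_iff C_def sum_distrib_left sum_distrib_right)
  qed
  have Psi_Q: "Psi v \<in> Q" if "v \<in> V i m" for v
    unfolding Psi_def using C_corner[OF that] z0 Q_act by blast
  have Psi_hom: "act a l (Psi v) - Psi (act a m v) \<in> N" if a: "a \<in> corner e i" and v: "v \<in> V i m" for a v
  proof -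
    \<comment> \<open>\<open>?D\<close> is the error of the cellular rule in column
      \<open>t\<close>. It lies in the corner and strictly above \<open>m\<close>, hence acts as
      zero modulo \<open>N\<close>.\<close>
    let ?D = "a * C v - C (act a m v)"
    have "C (act a m v) \<in> corner e i" using C_corner act_corner_in_V[OF i mL a] by blast
    moreover have "a * C v \<in> corner e i" using corner_mult[OF i a C_corner[OF v]] .
    ultimately have D: "?D \<in> corner e i"
      using i by (simp add: corner_iff left_diff_distrib right_diff_distrib)
    have "act ?D l z0 \<in> N"
    proof (rule kill[OF _ z0])
      fix m' x y assume m': "m' \<in> Lam" "x \<in> T m'" "y \<in> T m'"
        "\<not> (le m m' \<and> m' \<noteq> m \<and> x \<in> Ti i m' \<and> y \<in> Ti i m')"
      have tT: "t \<in> T m" using t Ti_D by blast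
      have eq: "coef m' x y ?D = (\<Sum>u\<in>T m. v u * coef m' x y (a * c m u t)) -
          (\<Sum>u\<in>T m. act a m v u * coef m' x y (c m u t))"
        by (simp add: C_def sum_distrib_left scale_mult_right)
      consider "\<not> (x \<in> Ti i m' \<and> y \<in> Ti i m')" | "m' = m" | "\<not> le m m'" "m' \<noteq> m" using m'(4) by blast
      then show "coef m' x y ?D = 0"
      proof cases
        case 1
        then show ?thesis using corner_coef_zero[OF i D m'(1-3)] by blast
      next
        case 2
        have "(\<Sum>u\<in>T m. act a m v u * coef m x y (c m u t)) =
          (\<Sum>u\<in>T m. if u = x then (if y = t then act a m v x else 0) else 0)"
          by (rule sum.cong) (use 2 m' mL tT in \<open>auto simp: coef_c\<close>)
        also have "\<dots> = (if y = t then act a m v x else 0)" using finite_T[OF mL] m' 2 by simp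
        finally have "(\<Sum>u\<in>T m. act a m v u * coef m x y (c m u t)) = (if y = t then act a m v x else 0)" .
        moreover have "(\<Sum>u\<in>T m. v u * coef m x y (a * c m u t)) = (if y = t then act a m v x else 0)"
          using 2 m' mL tT by (simp add: coef_mult_same act_apply mult.commute)
        ultimately show ?thesis unfolding eq using 2 by simp
      next
        case 3
        then show ?thesis unfolding eq using m' mL tT by (simp add: coef_mult_zero coef_c)
      qed
    qed
    then show ?thesis using l by (simp add: Psi_def act_diff_left act_mult)
  qed
  have Psi_c: "act (c m a b) l (Psi v) - fscale (pairing m b v) (Psi (unit a)) \<in> N"
    if "a \<in> Ti i m" "b \<in> Ti i m" "v \<in> V i m" for a b v
    using Psi_hom[OF c_corner[OF i mL that(1,2)] that(3)] that mL by (simp add: act_c Ti_D Psi_scale)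
  have Psi_s0: "Psi (unit s0) \<notin> N" using hit C_unit[OF Ti_D[OF s0]] by (simp add: Psi_def)
  have unit_s0: "unit s0 \<in> V i m" using s0 by (auto simp: unit_def cell_mod_def)
  have N_fscale: "k = 0" if "fscale k x \<in> N" "x \<notin> N" for k x
  proof (rule ccontr)
    assume "k \<noteq> 0"
    then have "fscale (inverse k) (fscale k x) = x" by simp
    then show False using N_scale[OF that(1), of "inverse k"] that(2) by simp
  qed
  \<comment> \<open>Apply \<open>c m s0 b\<close> to \<open>Psi v\<close>: modulo \<open>N\<close>
    this is \<open>pairing m b v\<close> times a vector outside \<open>N\<close>.\<close>
  have ker1: "v \<in> Rad m" if v: "v \<in> V i m" "Psi v \<in> N" for v
  proof -
    have "pairing m b v = 0" if b: "b \<in> T m" for b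
    proof (cases "b \<in> Ti i m")
      case True
      have "act (c m s0 b) l (Psi v) \<in> N" using N_act[OF c_corner[OF i mL s0 True] v(2)] .
      then have "fscale (pairing m b v) (Psi (unit s0)) \<in> N" using N_mem[OF Psi_c[OF s0 True v(1)]] by simp
      then show ?thesis using N_fscale Psi_s0 by blast
    qed (use pairing_cross[OF i mL b _ v(1)] in blast)
    then show ?thesis using mL v V_D by (simp add: Rad_iff)
  qed
  \<comment> \<open>Images of submodules, enlarged by \<open>N\<close>, lie between \<open>N\<close>
    and \<open>Q\<close>; simplicity then leaves only the two extremes.\<close>
  have image_submod: "corner_submod i l {n \<in> Q. \<exists>v\<in>W. n - Psi v \<in> N}"
    if W: "W \<subseteq> V i m" "fs.subspace W" "\<And>a v. a \<in> corner e i \<Longrightarrow> v \<in> W \<Longrightarrow> act a m v \<in> W" for W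
    unfolding sub_iff
  proof (intro conjI ballI)
    let ?X = "{n \<in> Q. \<exists>v\<in>W. n - Psi v \<in> N}"
    show "?X \<subseteq> V i l" using Q_V by blast
    show "fs.subspace ?X"
      unfolding fs.subspace_def
    proof (intro conjI ballI allI)
      have "Psi 0 = 0" using Psi_diff[of 0 0] by simp
      then have "(0 :: 't \<Rightarrow> 'k) - Psi 0 \<in> N" using N_0 by simp
      then show "0 \<in> ?X" using fs.subspace_0[OF W(2)] fs.subspace_0[OF Q_sub] by blast
      fix x y k assume x: "x \<in> ?X" and y: "y \<in> ?X"
      then obtain v w where vw: "v \<in> W" "x - Psi v \<in> N" "w \<in> W" "y - Psi w \<in> N" by blast
      have "(x + y) - Psi (v + w) \<in> N"
        using N_add[OF vw(2,4)] by (simp add: Psi_add algebra_simps)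
      then show "x + y \<in> ?X" using fs.subspace_add[OF W(2) vw(1,3)] x y Q_add by blast
    next
      fix x k assume x: "x \<in> ?X"
      then obtain v where v: "v \<in> W" "x - Psi v \<in> N" by blast
      have "fscale k x - Psi (fscale k v) \<in> N"
        using N_scale[OF v(2), of k] by (simp add: Psi_scale fs.scale_right_diff_distrib)
      then show "fscale k x \<in> ?X" using fs.subspace_scale[OF W(2) v(1)] x Q_scale by blast
    qed
    fix a x assume a: "a \<in> corner e i" and x: "x \<in> ?X"
    then obtain v where v: "v \<in> W" "x - Psi v \<in> N" by blast
    have "act a l x - act a l (Psi v) \<in> N" using N_act[OF a v(2)] by (simp add: act_diff_right)
    moreover have "act a l (Psi v) - Psi (act a m v) \<in> N" using Psi_hom a v W by blast
    ultimately have "act a l x - Psi (act a m v) \<in> N" by (rule N_trans)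
    then show "act a l x \<in> ?X" using W(3)[OF a v(1)] Q_act[OF a] x by blast
  qed
  have N_image: "N \<subseteq> {n \<in> Q. \<exists>v\<in>W. n - Psi v \<in> N}" if "0 \<in> W" for W
  proof -
    have "Psi 0 = 0" using Psi_diff[of 0 0] by simp
    then have "n - Psi 0 \<in> N" if "n \<in> N" for n using that by simp
    then show ?thesis using NQ that by blast
  qed
  have V_0: "0 \<in> V i m" and V_sub: "fs.subspace (V i m)"
    by (rule fs.subspace_0[OF Delta_subspace], rule Delta_subspace)
  have onto: "\<exists>v\<in>V i m. z - Psi v \<in> N" if z: "z \<in> Q" for z
  proof -
    let ?X = "{n \<in> Q. \<exists>v\<in>V i m. n - Psi v \<in> N}"
    have "corner_submod i l ?X"
      by (rule image_submod[OF subset_refl V_sub]) (use act_corner_in_V[OF i mL] in blast)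
    moreover have "Psi (unit s0) \<in> ?X"
      using unit_s0 Psi_Q[OF unit_s0] N_0 by (auto intro!: bexI[of _ "unit s0"])
    then have "N \<subset> ?X" using N_image[OF V_0] Psi_s0 by blast
    ultimately have "\<not> ?X \<subset> Q" using simple by blast
    then show ?thesis using z by blast
  qed
  \<comment> \<open>Otherwise the image of the radical would be all of \<open>Q\<close>. Then
    \<open>z0\<close> would come from a radical vector, and \<open>c m s0 t\<close> would send it
    into \<open>N\<close>, contrary to its choice.\<close>
  have ker2: "Psi v \<in> N" if v: "v \<in> V i m" "v \<in> Rad m" for v
  proof (rule ccontr)
    assume "Psi v \<notin> N"
    let ?X = "{n \<in> Q. \<exists>v\<in>Rad m \<inter> V i m. n - Psi v \<in> N}"
    have "corner_submod i l ?X"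
    proof (rule image_submod)
      show "fs.subspace (Rad m \<inter> V i m)"
        using fs.subspace_inter[OF Rad_subspace[OF mL] V_sub] .
    qed (use act_Rad[OF mL] act_corner_in_V[OF i mL] in auto)
    moreover have "Psi v \<in> ?X" using v Psi_Q[OF v(1)] N_0 by (auto intro!: bexI[of _ v])
    then have "N \<subset> ?X"
      using N_image[of "Rad m \<inter> V i m"] V_0 fs.subspace_0[OF Rad_subspace[OF mL]] \<open>Psi v \<notin> N\<close> by blast
    ultimately have "\<not> ?X \<subset> Q" using simple by blast
    then obtain w where w: "w \<in> Rad m" "w \<in> V i m" "z0 - Psi w \<in> N" using z0 by blast
    have "pairing m t w = 0" using w(1) t mL Ti_D by (simp add: Rad_iff)
    then have "act (c m s0 t) l (Psi w) \<in> N" using Psi_c[OF s0 t w(2)] by simp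
    moreover have "act (c m s0 t) l z0 - act (c m s0 t) l (Psi w) \<in> N"
      using N_act[OF c_corner[OF i mL s0 t] w(3)] by (simp add: act_diff_right)
    ultimately show False using N_mem hit by blast
  qed
  have "m \<in> Lam0 sc (Li i) le (Ti i) c"
  proof -
    \<comment> \<open>Some preimage of \<open>z0\<close> pairs nontrivially with index
      \<open>t\<close>, so the form of the corner cell is nonzero.\<close>
    obtain v where v: "v \<in> V i m" "z0 - Psi v \<in> N" using onto[OF z0] by blast
    have "act (c m s0 t) l z0 - act (c m s0 t) l (Psi v) \<in> N"
      using N_act[OF c_corner[OF i mL s0 t] v(2)] by (simp add: act_diff_right)
    then have "act (c m s0 t) l (Psi v) \<notin> N" using N_mem hit by blast
    then have "pairing m t v \<noteq> 0" using Psi_c[OF s0 t v(1)] by auto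
    then obtain s where "s \<in> T m" "phi m t s * v s \<noteq> 0"
      unfolding pairing_def by (meson sum.neutral)
    then have "s \<in> Ti i m" "phi m t s \<noteq> 0" using v by (auto simp: cell_mod_def)
    then have "form_coeff sc (Li i) le (Ti i) c m t s \<noteq> 0" using form_coeff_corner[OF i mL t] by simp
    then show ?thesis using t \<open>s \<in> Ti i m\<close> mL by (auto simp: Lam0_def Lam_idx_def)
  qed
  moreover have "subquot_iso sc (Li i) le (Ti i) c (corner e i) l N Q m
      (cell_rad sc (Li i) le (Ti i) c m) (cell_mod (Ti i) m)"
  proof -
    \<comment> \<open>\<open>subquot_iso\<close> asks for a linear map on all vectors, from
      \<open>Q\<close> to the cell module, opposite to \<open>Psi\<close>. Preimages under
      \<open>Psi\<close> are chosen on a basis of \<open>Q\<close> and extended linearly.\<close>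
    obtain B where B: "B \<subseteq> Q" "fs.independent B" "Q \<subseteq> fs.span B" "card B = fs.dim Q"
      by (rule fs.basis_exists)
    from onto B(1) obtain g where g: "\<And>y. y \<in> B \<Longrightarrow> g y \<in> V i m \<and> y - Psi (g y) \<in> N" by (meson subsetD)
    obtain f where f: "Vector_Spaces.linear fscale fscale f" "\<And>x. x \<in> B \<Longrightarrow> f x = g x"
      using fp.linear_independent_extend[OF B(2), of g] by blast
    interpret f: Vector_Spaces.linear fscale fscale f by (rule f(1))
    have fQ: "f y \<in> V i m \<and> y - Psi (f y) \<in> N" if "y \<in> Q" for y
    proof -
      have "y \<in> fs.span B" using that B by blast
      then show ?thesis
      proof (induction rule: fs.span_induct_alt)
        case base
        have "Psi 0 = 0" using Psi_diff[of 0 0] by simp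
        then have "f 0 \<in> V i m \<and> 0 - Psi (f 0) \<in> N" using N_0 V_0 by (simp add: f.zero)
        then show ?case .
      next
        case (step k x y)
        have gx: "f x \<in> V i m" "x - Psi (f x) \<in> N" using g[OF step(1)] f(2)[OF step(1)] by simp_all
        have gy: "f y \<in> V i m" "y - Psi (f y) \<in> N" using step(2) by (rule conjunct1, rule conjunct2)
        have "fscale k x + y - Psi (f (fscale k x + y)) = fscale k (x - Psi (f x)) + (y - Psi (f y))"
          by (simp add: f.add f.scale Psi_add Psi_scale fs.scale_right_diff_distrib)
        also have "\<dots> \<in> N" using gx gy by (intro N_add N_scale)
        finally have "fscale k x + y - Psi (f (fscale k x + y)) \<in> N" .
        moreover have "f (fscale k x + y) \<in> V i m"
          unfolding f.add f.scale using gx gy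
          by (intro fs.subspace_add[OF V_sub] fs.subspace_scale[OF V_sub])
        ultimately show ?case by (rule conjI[rotated])
      qed
    qed
    note rad = cell_rad_corner[OF i mL]
    show ?thesis
      unfolding subquot_iso_def
    proof (intro exI[of _ f] conjI allI ballI)
      show "f (\<lambda>u. x u + y u) = (\<lambda>u. f x u + f y u)" for x y
        using f.add[of x y] by (simp add: plus_fun_def)
      show "f (\<lambda>u. k * x u) = (\<lambda>u. k * f x u)" for k x
        using f.scale[of k x] by (simp add: fscale_def)
      show "f ` Q \<subseteq> cell_mod (Ti i) m" using fQ by blast
      show "{x \<in> Q. f x \<in> cell_rad sc (Li i) le (Ti i) c m} = N"
      proof (intro set_eqI iffI)
        fix x assume "x \<in> {x \<in> Q. f x \<in> cell_rad sc (Li i) le (Ti i) c m}"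
        then have x: "x \<in> Q" "f x \<in> Rad m" "f x \<in> V i m" by (auto simp: rad)
        then show "x \<in> N" using N_mem fQ[OF x(1)] ker2 by blast
      next
        fix x assume x: "x \<in> N"
        then have "x \<in> Q" using NQ by blast
        then have "Psi (f x) \<in> N" "f x \<in> V i m" using x N_mem fQ by blast+
        then show "x \<in> {x \<in> Q. f x \<in> cell_rad sc (Li i) le (Ti i) c m}"
          using \<open>x \<in> Q\<close> ker1 by (auto simp: rad)
      qed
      show "\<exists>x\<in>Q. (\<lambda>u. y u - f x u) \<in> cell_rad sc (Li i) le (Ti i) c m" if y: "y \<in> cell_mod (Ti i) m" for y
      proof (rule bexI[OF _ Psi_Q[OF y]])
        have "Psi (y - f (Psi y)) \<in> N" using fQ[OF Psi_Q[OF y]] by (simp add: Psi_diff)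
        moreover have "y - f (Psi y) \<in> V i m"
          using fs.subspace_diff[OF V_sub y] fQ[OF Psi_Q[OF y]] by blast
        ultimately have "y - f (Psi y) \<in> cell_rad sc (Li i) le (Ti i) c m" using ker1 by (simp add: rad)
        then show "(\<lambda>u. y u - f (Psi y) u) \<in> cell_rad sc (Li i) le (Ti i) c m" by (simp add: fun_diff_def)
      qed
      fix a x assume a: "a \<in> corner e i" and x: "x \<in> Q"
      have xV: "x \<in> V i l" using x Q_V by blast
      have ax: "act a l x \<in> Q" using Q_act a x by blast
      have fV: "f (act a l x) \<in> V i m" "f x \<in> V i m" using fQ x ax by blast+
      have 1: "Psi (f (act a l x)) - act a l x \<in> N" using N_sym fQ[OF ax] by blast
      have 2: "act a l x - act a l (Psi (f x)) \<in> N"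
        using N_act[OF a, of "x - Psi (f x)"] fQ[OF x] by (simp add: act_diff_right)
      have 3: "act a l (Psi (f x)) - Psi (act a m (f x)) \<in> N" using Psi_hom a fV by blast
      have "Psi (f (act a l x) - act a m (f x)) \<in> N"
        using N_trans[OF N_trans[OF 1 2] 3] by (simp add: Psi_diff)
      moreover have "f (act a l x) - act a m (f x) \<in> V i m"
        using fs.subspace_diff[OF V_sub fV(1)] act_corner_in_V[OF i mL a] by blast
      ultimately have "f (act a l x) - act a m (f x) \<in> cell_rad sc (Li i) le (Ti i) c m"
        using ker1 by (simp add: rad)
      then show "(\<lambda>u. f (cell_act sc (Li i) le (Ti i) c a l x) u -
          cell_act sc (Li i) le (Ti i) c a m (f x) u) \<in> cell_rad sc (Li i) le (Ti i) c m"
        using cell_act_corner[OF i l a xV] cell_act_corner[OF i mL a fV(2)] by (simp add: fun_diff_def)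
    qed
  qed
  moreover have "\<exists>s\<in>Ti i m. \<exists>t\<in>Ti i m. \<exists>z\<in>Q. act (c m s t) l z \<notin> N"
    using s0 t z0 hit by blast
  moreover have "act a l z \<in> N" if a: "a \<in> corner e i" "\<forall>v\<in>V i m. act a m v \<in> Rad m" and z: "z \<in> Q" for a z
  proof -
    obtain v where v: "v \<in> V i m" "z - Psi v \<in> N" using onto[OF z] by blast
    have "act a l z - act a l (Psi v) \<in> N" using N_act[OF a(1) v(2)] by (simp add: act_diff_right)
    moreover have "act a l (Psi v) - Psi (act a m v) \<in> N" using Psi_hom a v by blast
    ultimately have "act a l z - Psi (act a m v) \<in> N" by (rule N_trans)
    moreover have "Psi (act a m v) \<in> N" using ker2 a v act_corner_in_V[OF i mL a(1)] by blast
    ultimately show ?thesis using N_mem by blast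
  qed
  ultimately show ?thesis by blast
qed

section \<open>Linkage and submodules of cell modules\<close>

abbreviation linked where
  "linked i \<equiv> cell_linked sc (Li i) le (Ti i) c (corner e i)"

definition series :: "'i \<Rightarrow> 'l \<Rightarrow> ('t \<Rightarrow> 'k) set list" where
  "series i l = (SOME Ms. comp_series sc (Li i) le (Ti i) c (corner e i) l Ms)"

lemma comp_series_series:
  assumes "l \<in> Lam"
  shows "comp_series sc (Li i) le (Ti i) c (corner e i) l (series i l)"
proof -
  have "finite (Ti i l)" using finite_T[OF assms] Ti_subset finite_subset by blast
  from someI_ex[OF ex_comp_series[where T = "Ti i" and l = l, OF this]] show ?thesis
    unfolding series_def .
qed

definition factor_indices :: "'i \<Rightarrow> 'l \<Rightarrow> 'l \<Rightarrow> nat set" where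
  "factor_indices i l m = {k. Suc k < length (series i l) \<and>
    subquot_iso sc (Li i) le (Ti i) c (corner e i) l (series i l ! k) (series i l ! Suc k) m
      (cell_rad sc (Li i) le (Ti i) c m) (cell_mod (Ti i) m)}"

text \<open>The decomposition number is the cardinality of a finite set of positions, so it is
  nonzero exactly when a matching factor occurs.\<close>

lemma linked_iff:
  "linked i l m \<longleftrightarrow> l \<in> Li i \<and> m \<in> Lam0 sc (Li i) le (Ti i) c \<and> factor_indices i l m \<noteq> {}"
proof -
  have "decomp_num sc (Li i) le (Ti i) c (corner e i) l m = card (factor_indices i l m)"
    by (simp only: decomp_num_def factor_indices_def series_def Let_def)
  moreover have "finite (factor_indices i l m)"
    by (rule finite_subset[of _ "{..<length (series i l)}"]) (auto simp: factor_indices_def)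
  ultimately show ?thesis by (simp add: cell_linked_def)
qed

text \<open>Some \<open>e i\<close> maps a vector of \<open>M\<close> to a nonzero vector
  \<open>w\<close>, which enters the composition series of the corner cell module at a certain
  factor. The label \<open>m\<close> of that factor is linked to \<open>l\<close>. The last two
  clauses transfer information between \<open>M\<close> and \<open>m\<close>: the cell
  \<open>m\<close> acts nontrivially on \<open>M\<close>, and an element that is zero on the head of
  \<open>m\<close> cannot be the identity on \<open>M\<close>.\<close>

lemma submodule_link:
  assumes l: "l \<in> Lam" and M_sub: "fs.subspace M" and M_Delta: "M \<subseteq> Delta l"
    and M_act: "\<And>a x. x \<in> M \<Longrightarrow> act a l x \<in> M" and x0: "x0 \<in> M" "x0 \<noteq> 0"
  shows "\<exists>i\<in>I. \<exists>m. linked i l m \<and>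
    (\<exists>x\<in>M. \<exists>s\<in>T m. \<exists>t\<in>T m. act (c m s t) l x \<noteq> 0) \<and>
    (\<forall>a. (\<forall>v\<in>Delta m. act a m v \<in> Rad m) \<longrightarrow> (\<exists>x\<in>M. act a l x \<noteq> x))"
proof -
  have "(\<Sum>i\<in>I. act (e i) l x0) = act 1 l x0" by (simp only: act_sum_left[OF l, symmetric] sum_e)
  also have "\<dots> = x0" using act_one[OF l] x0(1) M_Delta by blast
  finally have "\<not> (\<forall>i\<in>I. act (e i) l x0 = 0)" using x0(2) sum.neutral by force
  then obtain i where i: "i \<in> I" and "act (e i) l x0 \<noteq> 0" by blast
  define w where "w = act (e i) l x0"
  have w: "w \<in> M" "w \<in> V i l" "w \<noteq> 0"
    using M_act x0 act_corner_in_V[OF i l e_corner[OF i]] \<open>act (e i) l x0 \<noteq> 0\<close> by (auto simp: w_def)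
  have lLi: "l \<in> Li i"
  proof (rule ccontr)
    assume "l \<notin> Li i"
    then have "w u = 0" for u using l w(2) by (auto simp: Lam_idx_def cell_mod_def)
    then show False using w(3) by (auto simp: fun_eq_iff)
  qed
  let ?Ms = "series i l"
  note cs = comp_series_series[OF l, of i, unfolded comp_series_def]
  \<comment> \<open>The first term containing \<open>w\<close>. The series starts with the zero
    module, so \<open>j\<close> has a predecessor \<open>k\<close>, and \<open>w\<close> is nonzero
    in the factor between them.\<close>
  define j where "j = (LEAST j. j < length ?Ms \<and> w \<in> ?Ms ! j)"
  have "length ?Ms - 1 < length ?Ms \<and> w \<in> ?Ms ! (length ?Ms - 1)"
    using cs w(2) last_conv_nth[of ?Ms] by simp
  then have j: "j < length ?Ms" "w \<in> ?Ms ! j"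
    unfolding j_def by (metis (mono_tags, lifting) LeastI)+
  have "j \<noteq> 0"
  proof
    assume "j = 0"
    then have "w \<in> {\<lambda>_. 0}" using cs j hd_conv_nth[of ?Ms] by metis
    then show False using w(3) by (simp add: zero_fun_def)
  qed
  then obtain k where k: "j = Suc k" using not0_implies_Suc by blast
  have wk: "w \<notin> ?Ms ! k"
    using not_less_Least[of k "\<lambda>j. j < length ?Ms \<and> w \<in> ?Ms ! j"] j k by (auto simp: j_def)
  let ?N = "?Ms ! k" and ?Q = "?Ms ! Suc k"
  have N: "corner_submod i l ?N" and Q: "corner_submod i l ?Q" and NQ: "?N \<subset> ?Q"
    and simple: "\<not> (\<exists>X. corner_submod i l X \<and> ?N \<subset> X \<and> X \<subset> ?Q)"
    using cs j(1) k by auto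
  obtain m where m: "m \<in> Lam0 sc (Li i) le (Ti i) c"
    "subquot_iso sc (Li i) le (Ti i) c (corner e i) l ?N ?Q m
      (cell_rad sc (Li i) le (Ti i) c m) (cell_mod (Ti i) m)"
    and hit: "\<exists>s\<in>Ti i m. \<exists>t\<in>Ti i m. \<exists>z\<in>?Q. act (c m s t) l z \<notin> ?N"
    and kill: "\<And>a z. a \<in> corner e i \<Longrightarrow> (\<And>v. v \<in> V i m \<Longrightarrow> act a m v \<in> Rad m) \<Longrightarrow> z \<in> ?Q \<Longrightarrow> act a l z \<in> ?N"
    using simple_factor[OF i l N Q NQ simple] by blast
  have mL: "m \<in> Lam" using m(1) Li_D by (auto simp: Lam0_def)
  have "linked i l m" using lLi m j(1) k unfolding linked_iff factor_indices_def by blast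
  moreover have "\<exists>x\<in>M. \<exists>s\<in>T m. \<exists>t\<in>T m. act (c m s t) l x \<noteq> 0"
  proof -
    note N' = N[unfolded corner_submod_iff[OF i l]] and Q' = Q[unfolded corner_submod_iff[OF i l]]
    have N_sub: "fs.subspace ?N" and Q_sub: "fs.subspace ?Q" using N' Q' by auto
    \<comment> \<open>This sum contains \<open>w\<close> and is therefore larger than
      \<open>?N\<close>, so simplicity makes it all of \<open>?Q\<close>. Hence each class of the
      factor has a representative in \<open>M\<close>.\<close>
    let ?X = "{x + n | x n. x \<in> M \<inter> ?Q \<and> n \<in> ?N}"
    have "?X \<subseteq> ?Q" using NQ fs.subspace_add[OF Q_sub] by blast
    have "corner_submod i l ?X"
      unfolding corner_submod_iff[OF i l]
    proof (intro conjI ballI)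
      show "?X \<subseteq> V i l" using \<open>?X \<subseteq> ?Q\<close> Q' by blast
      show "fs.subspace ?X"
        using fs.subspace_sums[OF fs.subspace_inter[OF M_sub Q_sub] N_sub] .
      fix a x assume a: "a \<in> corner e i" and "x \<in> ?X"
      then obtain y n where y: "x = y + n" "y \<in> M" "y \<in> ?Q" "n \<in> ?N" by blast
      then have "act a l y \<in> M \<inter> ?Q" "act a l n \<in> ?N" using a M_act N' Q' by blast+
      then show "act a l x \<in> ?X" unfolding y(1) act_add_right by blast
    qed
    moreover have "?N \<subset> ?X"
    proof -
      have "n \<in> ?X" if "n \<in> ?N" for n
        using that fs.subspace_0[OF M_sub] fs.subspace_0[OF Q_sub] by (metis (mono_tags, lifting) IntI add_0 mem_Collect_eq)
      moreover have "w \<in> ?X"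
        using w(1) j(2) k fs.subspace_0[OF N_sub] by (metis (mono_tags, lifting) IntI add_0_right mem_Collect_eq)
      ultimately show ?thesis using wk by blast
    qed
    ultimately have "?X = ?Q" using simple \<open>?X \<subseteq> ?Q\<close> by blast
    obtain s t z where st: "s \<in> Ti i m" "t \<in> Ti i m" "z \<in> ?Q" "act (c m s t) l z \<notin> ?N" using hit by blast
    then obtain x n where x: "z = x + n" "x \<in> M" "n \<in> ?N" using \<open>?X = ?Q\<close> by blast
    have "act (c m s t) l n \<in> ?N" using c_corner[OF i mL st(1,2)] x(3) N' by blast
    then have "act (c m s t) l x \<noteq> 0"
      using st(4) unfolding x(1) act_add_right by auto
    then show ?thesis using x(2) st(1,2) Ti_D by blast
  qed
  moreover have "\<exists>x\<in>M. act a l x \<noteq> x" if a: "\<forall>v\<in>Delta m. act a m v \<in> Rad m" for a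
  proof (rule ccontr)
    assume "\<not> ?thesis"
    then have fix_M: "act a l x = x" if "x \<in> M" for x using that by blast
    \<comment> \<open>Compressed to the corner, \<open>a\<close> still fixes \<open>w\<close> but
      now must send it into \<open>?N\<close>.\<close>
    let ?a = "e i * a * e i"
    have "?a \<in> corner e i" by (auto simp: corner_def)
    moreover have "act ?a m v \<in> Rad m" if "v \<in> V i m" for v
      using a act_Rad[OF mL] by (simp add: act_mult[OF mL])
    ultimately have "act ?a l w \<in> ?N" using kill j(2) k by blast
    moreover have "act ?a l w = w" using w act_e[OF i l] fix_M by (simp add: act_mult[OF l])
    ultimately show False using wk by simp
  qed
  ultimately show ?thesis using i by blast
qed

section \<open>Splitting idempotents\<close>

text \<open>Linkage is taken in all corners at once: \<open>S\<close> never separates two labels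
  linked in some corner.\<close>

definition link_closed :: "'l set \<Rightarrow> bool" where
  "link_closed S \<longleftrightarrow> (\<forall>i\<in>I. \<forall>l m. linked i l m \<longrightarrow> (l \<in> S \<longleftrightarrow> m \<in> S))"

text \<open>By minimality, a cell of \<open>G\<close> other than \<open>l\<close> is not below
  \<open>l\<close> and acts as zero. The cell \<open>l\<close> itself acts through
  \<open>pairing\<close>, which vanishes on the radical.\<close>

lemma act_ideal_Rad:
  assumes "l \<in> Lam" "\<forall>y\<in>G. le y l \<longrightarrow> y = l" "z \<in> ideal G" "v \<in> Rad l"
  shows "act z l v = 0"
  using assms(3)
proof (induction rule: ideal_induct)
  case zero
  show ?case using assms(1) by (rule act_zero_left)
next
  case (add x y)
  show ?case unfolding act_add_left[OF assms(1)] using add by simp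
next
  case (basis k m s t)
  have "act (c m s t) l v = 0"
  proof (cases "m = l")
    case True
    then show ?thesis using basis assms by (simp add: act_c Rad_iff)
  next
    case False
    then have "\<not> le m l" using assms(2) basis by blast
    then show ?thesis using basis assms(1) by (auto simp: fun_eq_iff act_apply R_c_zero)
  qed
  then show ?case using act_scale_left[OF assms(1)] by simp
qed

text \<open>On the radical, where \<open>ideal G\<close> vanishes, \<open>a\<close> is an idempotent
  endomorphism, and its fixed part is a submodule. If that were nonzero,
  \<open>submodule_link\<close> would give a label \<open>m\<close> in \<open>S\<close> linked to
  \<open>l\<close>. It lies outside \<open>G\<close>, because cells of \<open>G\<close> kill the
  radical, so \<open>a\<close> is zero on its head, a contradiction.\<close>

lemma Rad_annihilated:
  assumes S: "link_closed S" and l: "l \<in> Lam" "l \<in> S"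
    and G: "up_closed G" "\<forall>y\<in>G. le y l \<longrightarrow> y = l"
    and a: "a * a - a \<in> ideal G" "\<And>x. a * x - x * a \<in> ideal G"
      "\<forall>n\<in>Lam - G. n \<in> S \<longrightarrow> (\<forall>v\<in>Delta n. act a n v \<in> Rad n)"
    and v: "v \<in> Rad l"
  shows "act a l v = 0"
proof (rule ccontr)
  assume nz: "act a l v \<noteq> 0"
  note J = act_ideal_Rad[OF l(1) G(2)]
  let ?M = "{v \<in> Rad l. act a l v = v}"
  have M_sub: "fs.subspace ?M"
    using fs.subspace_0[OF Rad_subspace[OF l(1)]] fs.subspace_add[OF Rad_subspace[OF l(1)]]
      fs.subspace_scale[OF Rad_subspace[OF l(1)]]
    by (simp add: fs.subspace_def act_add_right act_fscale)
  have M_Delta: "?M \<subseteq> Delta l" by (auto simp: cell_rad_def)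
  have M_act: "act x l u \<in> ?M" if u: "u \<in> ?M" for x u
  proof -
    have "act (a * x - x * a) l u = 0" using J[OF a(2)] u by simp
    then have "act a l (act x l u) = act x l u" using u l(1) by (simp add: act_diff_left act_mult)
    then show ?thesis using u act_Rad[OF l(1)] by simp
  qed
  have "act (a * a - a) l v = 0" using J[OF a(1) v] .
  then have "act a l v \<in> ?M" using l(1) v by (simp add: act_diff_left act_mult act_Rad)
  from submodule_link[OF l(1) M_sub M_Delta M_act this nz]
  obtain i m where i: "i \<in> I" and link: "linked i l m"
    and hit: "\<exists>x\<in>?M. \<exists>s\<in>T m. \<exists>t\<in>T m. act (c m s t) l x \<noteq> 0"
    and ex: "(\<forall>v\<in>Delta m. act a m v \<in> Rad m) \<longrightarrow> (\<exists>x\<in>?M. act a l x \<noteq> x)" by blast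
  have "m \<in> Lam" using link Li_D by (auto simp: cell_linked_def Lam0_def)
  moreover have "m \<notin> G"
  proof
    assume "m \<in> G"
    obtain x s t where x: "x \<in> ?M" "s \<in> T m" "t \<in> T m" "act (c m s t) l x \<noteq> 0" using hit by blast
    then have "c m s t \<in> ideal G" using \<open>m \<in> G\<close> \<open>m \<in> Lam\<close> by (auto simp: ideal_def coef_c)
    then show False using J x by blast
  qed
  moreover have "m \<in> S" using S link i l(2) unfolding link_closed_def by blast
  ultimately have "\<forall>v\<in>Delta m. act a m v \<in> Rad m" using a(3) by blast
  then show False using ex by blast
qed

text \<open>\<open>b\<close> is, modulo \<open>ideal G\<close>, the central idempotent separating \<open>S\<close> from its
  complement in the quotient by the cells in \<open>G\<close>.\<close>

definition splits :: "'l set \<Rightarrow> 'l set \<Rightarrow> 'a \<Rightarrow> bool" where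
  "splits S G b \<longleftrightarrow> b * b - b \<in> ideal G \<and> (\<forall>x. b * x - x * b \<in> ideal G) \<and> star b - b \<in> ideal G \<and>
     (\<forall>n\<in>Lam - G. \<forall>v\<in>Delta n.
        (n \<in> S \<longrightarrow> act b n v - v \<in> Rad n) \<and> (n \<notin> S \<longrightarrow> act b n v \<in> Rad n))"

text \<open>Passing to complements lets every added cell be treated as one belonging to the chosen
  set.\<close>

lemma splits_compl:
  assumes "splits S G b"
  shows "splits (- S) G (1 - b)"
  unfolding splits_def
proof (intro conjI allI ballI)
  show "(1 - b) * (1 - b) - (1 - b) \<in> ideal G"
    using assms by (simp add: splits_def algebra_simps)
  show "(1 - b) * x - x * (1 - b) \<in> ideal G" for x
    using assms ideal_neg[of "b * x - x * b"] by (simp add: splits_def algebra_simps)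
  show "star (1 - b) - (1 - b) \<in> ideal G"
    using assms ideal_neg[of "star b - b"] by (simp add: splits_def star_diff)
  fix n v assume n: "n \<in> Lam - G" and v: "v \<in> Delta n"
  have "act (1 - b) n v = v - act b n v" using n v by (simp add: act_diff_left act_one)
  moreover have "n \<in> S \<longrightarrow> act b n v - v \<in> Rad n" "n \<notin> S \<longrightarrow> act b n v \<in> Rad n"
    using assms n v by (auto simp: splits_def)
  moreover have "- x \<in> Rad n" if "x \<in> Rad n" for x
    using fs.subspace_neg[OF Rad_subspace that] n by blast
  ultimately show "n \<in> - S \<longrightarrow> act (1 - b) n v - v \<in> Rad n" "n \<notin> - S \<longrightarrow> act (1 - b) n v \<in> Rad n"
    by (simp, metis ComplI minus_diff_eq)
qed

lemma splits_step:
  assumes S: "link_closed S" and l: "l \<in> G" "l \<in> S"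
    and G: "up_closed G" "up_closed (G - {l})" "\<forall>y\<in>G. le y l \<longrightarrow> y = l"
    and b: "splits S G b"
  shows "\<exists>b'. splits S (G - {l}) b'"
proof -
  have lL: "l \<in> Lam" using G(1) l(1) by (auto simp: up_closed_def)
  note tr = vs.subspace_cong_trans[OF ideal_subspace] and sym = vs.subspace_cong_sym[OF ideal_subspace]
  have mult: "x * x' - y * y' \<in> ideal G" if "x - y \<in> ideal G" "x' - y' \<in> ideal G" for x x' y y'
  proof -
    have "(x - y) * x' + y * (x' - y') \<in> ideal G"
      using that G(1) by (intro ideal_add ideal_mult_left ideal_mult_right)
    then show ?thesis by (simp add: algebra_simps)
  qed
  define a0 where "a0 = 1 - b"
  have sp: "splits (- S) G a0" using splits_compl[OF b] by (simp add: a0_def)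
  have a0: "a0 * a0 - a0 \<in> ideal G" "\<And>x. a0 * x - x * a0 \<in> ideal G" "star a0 - a0 \<in> ideal G"
    and a0_S: "\<And>n v. n \<in> Lam - G \<Longrightarrow> n \<in> S \<Longrightarrow> v \<in> Delta n \<Longrightarrow> act a0 n v \<in> Rad n"
    and a0_nS: "\<And>n v. n \<in> Lam - G \<Longrightarrow> n \<notin> S \<Longrightarrow> v \<in> Delta n \<Longrightarrow> act a0 n v - v \<in> Rad n"
    using sp by (auto simp: splits_def)
  have a0_Rad: "act a0 l v = 0" if "v \<in> Rad l" for v
    using Rad_annihilated[OF S lL l(2) G(1,3) a0(1,2) _ that] a0_S by blast
  obtain q where q: "q \<in> ideal G" "\<And>v. v \<in> Delta l \<Longrightarrow> act q l v - v \<in> Rad l"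
    using ex_identity_on_head[OF lL l(1)] by blast
  \<comment> \<open>\<open>q\<close> is the identity on the head of \<open>l\<close>, so
    \<open>a\<close> is zero there, while it agrees with \<open>a0\<close> modulo
    \<open>ideal G\<close>.\<close>
  define a where "a = a0 - a0 * q"
  \<comment> \<open>\<open>a\<close> maps the cell module into its radical and kills the radical. By
    adjointness the same holds for \<open>star a\<close>, so \<open>g\<close> and
    \<open>star g\<close> both annihilate the cell module.\<close>
  define g where "g = a * a"
  have a_a0: "a - a0 \<in> ideal G"
    using ideal_neg[OF ideal_mult_left[OF G(1) q(1)], of a0] by (simp add: a_def)
  have star_a: "star a - a0 \<in> ideal G"
    using tr[of "star a" "star a0" G a0] ideal_star[OF a_a0] a0(3) by (simp add: star_diff)
  have on_Rad: "act y l w = 0" if "y - a0 \<in> ideal G" "w \<in> Rad l" for y w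
    using act_ideal_Rad[OF lL G(3) that] a0_Rad[OF that(2)] lL by (simp add: act_diff_left)
  have a_Rad: "act a l v \<in> Rad l" if v: "v \<in> Delta l" for v
  proof -
    have "act a l v = act a0 l (v - act q l v)"
      using lL by (simp add: a_def act_diff_left act_mult act_diff_right)
    moreover have "v - act q l v \<in> Rad l"
      using fs.subspace_cong_sym[OF Rad_subspace[OF lL] q(2)[OF v]] .
    ultimately show ?thesis using act_Rad[OF lL] by simp
  qed
  have g_l: "act g l v = 0" if "v \<in> Delta l" for v
    using on_Rad[OF a_a0 a_Rad[OF that]] lL by (simp add: g_def act_mult)
  have star_g_l: "act (star g) l v = 0" if "v \<in> Delta l" for v
    using on_Rad[OF star_a act_star_Rad[OF lL a_Rad]] lL by (simp add: g_def star_mult act_mult)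
  have star_star_g_l: "act (star (star g)) l v = 0" if "v \<in> Delta l" for v
    using g_l[OF that] by simp
  \<comment> \<open>Multiplying an error in \<open>ideal G\<close> by \<open>g\<close> or
    \<open>star g\<close> removes its part in the cell \<open>l\<close>.\<close>
  have left: "g * z \<in> ideal (G - {l})" and right: "z * g \<in> ideal (G - {l})"
    and right_star: "z * star g \<in> ideal (G - {l})" if "z \<in> ideal G" for z
    by (rule mult_ideal_diff[OF G(1) l(1) G(2) _ that] mult_ideal_diff_right[OF G(1) l(1) G(2) _ that],
        use g_l star_g_l in simp)+
  have g_a0: "g - a0 \<in> ideal G" unfolding g_def using tr[OF mult[OF a_a0 a_a0] a0(1)] .
  have gg: "g * g - g \<in> ideal G" using tr[OF tr[OF mult[OF g_a0 g_a0] a0(1)] sym[OF g_a0]] .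
  have gx: "g * x - x * g \<in> ideal G" for x
  proof -
    have 1: "x - x \<in> ideal G" by (simp add: ideal_zero)
    show ?thesis using tr[OF tr[OF mult[OF g_a0 1] a0(2)] mult[OF 1 sym[OF g_a0]]] .
  qed
  have star_g: "star g - g \<in> ideal G"
  proof -
    have "star g - star a0 \<in> ideal G" using ideal_star[OF g_a0] by (simp add: star_diff)
    then show ?thesis using tr[OF tr[OF _ a0(3)] sym[OF g_a0]] by blast
  qed
  \<comment> \<open>Squaring once more supplies the factors \<open>g\<close>: each defect of
    \<open>h\<close> is a combination of defects of \<open>g\<close> multiplied by \<open>g\<close>
    or \<open>star g\<close>, and thus lies in the smaller ideal.\<close>
  define h where "h = g * g"
  let ?J = "ideal (G - {l})"
  have "splits (- S) (G - {l}) h"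
    unfolding splits_def
  proof (intro conjI allI ballI)
    have 3: "g * (g * g - g) \<in> ?J" using left[OF gg] .
    then have "g * (g * (g * g - g)) + g * (g * g - g) \<in> ?J"
      using ideal_add ideal_mult_left[OF G(2)] by blast
    then show "h * h - h \<in> ?J" by (simp add: h_def algebra_simps)
    show "h * x - x * h \<in> ?J" for x
      using ideal_add[OF left[OF gx[of x]] right[OF gx[of x]]] by (simp add: h_def algebra_simps)
    show "star h - h \<in> ?J"
      using ideal_add[OF left[OF star_g] right_star[OF star_g]]
      by (simp add: h_def star_mult algebra_simps)
    fix n v assume n: "n \<in> Lam - (G - {l})" and v: "v \<in> Delta n"
    have nL: "n \<in> Lam" using n by blast
    have h_act: "act h n v = act a n (act a n (act a n (act a n v)))" for v
      using nL by (simp add: h_def g_def act_mult)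
    show "n \<notin> - S \<longrightarrow> act h n v \<in> Rad n"
    proof
      assume "n \<notin> - S"
      have "act a n v \<in> Rad n"
      proof (cases "n = l")
        case True
        then show ?thesis using a_Rad v by simp
      next
        case False
        then have "n \<notin> G" "n \<in> Lam - G" using n by auto
        then show ?thesis
          using act_cong_ideal[OF nL G(1) _ a_a0, of v] a0_S v \<open>n \<notin> - S\<close> by simp
      qed
      then show "act h n v \<in> Rad n" unfolding h_act using act_Rad[OF nL] by blast
    qed
    show "n \<in> - S \<longrightarrow> act h n v - v \<in> Rad n"
    proof
      assume nS: "n \<in> - S"
      then have "n \<noteq> l" using l by auto
      then have n': "n \<notin> G" "n \<in> Lam - G" using n by auto
      have one: "act a n u - u \<in> Rad n" if "u \<in> Delta n" for u
        using act_cong_ideal[OF nL G(1) n'(1) a_a0, of u] a0_nS[OF n'(2) _ that] nS by simp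
      note tr' = fs.subspace_cong_trans[OF Rad_subspace[OF nL]]
      show "act h n v - v \<in> Rad n"
        unfolding h_act
        by (rule tr'[OF one tr'[OF one tr'[OF one one]]]) (auto simp: v)
    qed
  qed
  from splits_compl[OF this] show ?thesis by auto
qed

lemma link_closed_compl: "link_closed S \<Longrightarrow> link_closed (- S)"
  by (auto simp: link_closed_def)

text \<open>Induction on the number of cells outside \<open>G\<close>. A maximal outside label
  \<open>l\<close> is minimal in the up-closed set \<open>insert l G\<close>, so
  \<open>splits_step\<close> applies to it.\<close>

lemma ex_splits:
  assumes S: "link_closed S" and "up_closed G"
  shows "\<exists>b. splits S G b"
  using assms(2)
proof (induction "card (Lam - G)" arbitrary: G rule: less_induct)
  case less
  have G: "G \<subseteq> Lam" using less.prems by (simp add: up_closed_def)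
  show ?case
  proof (cases "G = Lam")
    case True
    \<comment> \<open>No label is left outside \<open>G\<close>, and the congruences for 0 are
      trivial.\<close>
    then have "splits S G 0" by (simp add: splits_def ideal_zero)
    then show ?thesis by blast
  next
    case False
    then obtain l where l: "l \<in> Lam - G" "\<And>y. y \<in> Lam - G \<Longrightarrow> le l y \<Longrightarrow> y = l"
      using ex_maximal[of "Lam - G"] G by blast
    let ?G = "insert l G"
    have up: "up_closed ?G" using less.prems l unfolding up_closed_def by blast
    have diff: "?G - {l} = G" using l by auto
    have min: "\<forall>y\<in>?G. le y l \<longrightarrow> y = l"
      using less.prems l(1) unfolding up_closed_def by blast
    have "Lam - ?G \<subset> Lam - G" using l by blast
    then have "card (Lam - ?G) < card (Lam - G)" using finite_Lam by (intro psubset_card_mono) auto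
    from less.hyps[OF this up] obtain b where b: "splits S ?G b" by blast
    have up': "up_closed (?G - {l})" using less.prems diff by simp
    show ?thesis
    proof (cases "l \<in> S")
      case True
      show ?thesis using splits_step[OF S insertI1 True up up' min b] diff by simp
    next
      case False
      then have "l \<in> - S" by simp
      from splits_step[OF link_closed_compl[OF S] insertI1 this up up' min splits_compl[OF b]]
      obtain b' where "splits (- S) (?G - {l}) b'" by blast
      from splits_compl[OF this] show ?thesis using diff by auto
    qed
  qed
qed

text \<open>For empty \<open>G\<close> the ideal is zero, so the congruences in
  \<open>splits\<close> become equations in the algebra.\<close>

lemma ex_splitting_idempotent:
  assumes "link_closed S" "Lam_0 = Lam"
  shows "\<exists>b. central b \<and> b * b = b \<and> (\<forall>n\<in>Lam. central_char b n = (if n \<in> S then 1 else 0))"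
proof -
  have "up_closed {}" by (simp add: up_closed_def)
  from ex_splits[OF assms(1) this] obtain b where b: "splits S {} b" by blast
  then have "b * b - b = 0" "\<And>x. b * x - x * b = 0" unfolding splits_def ideal_empty by blast+
  then have cen: "central b" "b * b = b" unfolding central_def right_minus_eq by blast+
  have "central_char b n = (if n \<in> S then 1 else 0)" if "n \<in> Lam" for n
    using that b cen assms(2) by (intro central_char_eqI) (auto simp: splits_def)
  then show ?thesis using cen by blast
qed

section \<open>Blocks and linkage classes\<close>

text \<open>The corner element \<open>e i * b * e i\<close> acts on the corner cell modules of
  \<open>l\<close> and \<open>m\<close> by the two central characters. The isomorphism of a
  composition factor with the nonzero head of \<open>m\<close> intertwines these scalars.\<close>

lemma central_char_linked:
  assumes i: "i \<in> I" and L0: "Lam_0 = Lam" and link: "linked i l m" and b: "central b"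
  shows "central_char b l = central_char b m"
proof (rule ccontr)
  assume ne: "central_char b l \<noteq> central_char b m"
  obtain k where lm: "l \<in> Li i" "m \<in> Lam0 sc (Li i) le (Ti i) c" and k: "Suc k < length (series i l)"
    and iso: "subquot_iso sc (Li i) le (Ti i) c (corner e i) l (series i l ! k) (series i l ! Suc k) m
      (cell_rad sc (Li i) le (Ti i) c m) (cell_mod (Ti i) m)"
    using link unfolding linked_iff factor_indices_def by blast
  have lL: "l \<in> Lam" and mL: "m \<in> Lam" using lm Li_D by (auto simp: Lam0_def)
  have "corner_submod i l (series i l ! Suc k)"
    using comp_series_series[OF lL, of i] k unfolding comp_series_def by blast
  then have QV: "series i l ! Suc k \<subseteq> V i l" using corner_submod_iff[OF i lL] by blast
  note rad = cell_rad_corner[OF i mL]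
  obtain f where f_scale: "\<forall>k x. f (\<lambda>u. k * x u) = (\<lambda>u. k * f x u)"
    and fQ: "f ` (series i l ! Suc k) \<subseteq> V i m"
    and onto: "\<forall>y\<in>V i m. \<exists>x\<in>series i l ! Suc k. (\<lambda>u. y u - f x u) \<in> Rad m \<inter> V i m"
    and hom: "\<forall>a\<in>corner e i. \<forall>x\<in>series i l ! Suc k.
      (\<lambda>u. f (cell_act sc (Li i) le (Ti i) c a l x) u - cell_act sc (Li i) le (Ti i) c a m (f x) u) \<in> Rad m \<inter> V i m"
    using iso unfolding subquot_iso_def rad by (elim exE conjE) (rule that)
  \<comment> \<open>A nonzero entry of the Gram matrix provides a vector outside the radical, and
    surjectivity provides \<open>x\<close> mapping to it modulo the radical.\<close>
  obtain s t where st: "s \<in> Ti i m" "t \<in> Ti i m" "phi m s t \<noteq> 0"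
    using lm(2) form_coeff_corner[OF i mL] by (auto simp: Lam0_def)
  have "unit t \<in> V i m" using st by (auto simp: unit_def cell_mod_def)
  from onto[rule_format, OF this] obtain x where x: "x \<in> series i l ! Suc k" "unit t - f x \<in> Rad m"
    by (auto simp: fun_diff_def)
  have "unit t \<notin> Rad m" using st mL by (auto simp: Rad_iff pairing_unit Ti_D)
  then have fx: "f x \<notin> Rad m" using fs.subspace_cong_mem[OF Rad_subspace[OF mL] x(2)] by simp
  let ?b = "e i * b * e i"
  have bc: "?b \<in> corner e i" by (auto simp: corner_def)
  have act_b: "act ?b n v = fscale (central_char b n) v" if n: "n \<in> Lam" and v: "v \<in> V i n" for n v
    using act_central[of n b v] n v L0 b act_e[OF i n v] V_D[OF v]
    by (simp add: act_mult[OF n] act_fscale)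
  have xV: "x \<in> V i l" and fxV: "f x \<in> V i m" using x QV fQ by blast+
  have "f (fscale (central_char b l) x) - fscale (central_char b m) (f x) \<in> Rad m"
    using hom[rule_format, OF bc x(1)] cell_act_corner[OF i lL bc xV] cell_act_corner[OF i mL bc fxV]
      act_b[OF lL xV] act_b[OF mL fxV] by (simp add: fun_diff_def)
  moreover have "f (fscale (central_char b l) x) = fscale (central_char b l) (f x)"
    using f_scale[rule_format, of "central_char b l" x] by (simp add: fscale_def)
  ultimately have "fscale (central_char b l - central_char b m) (f x) \<in> Rad m"
    by (simp add: fs.scale_left_diff_distrib)
  then have "fscale (inverse (central_char b l - central_char b m)) (fscale (central_char b l - central_char b m) (f x)) \<in> Rad m"
    by (rule fs.subspace_scale[OF Rad_subspace[OF mL]])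
  then show False using ne fx by simp
qed

abbreviation same_cell where "same_cell \<equiv> same_cell_block_idx sc Lam le T c e"

lemma central_char_same_cell:
  assumes "i \<in> I" "Lam_0 = Lam" "central b" "same_cell i l m"
  shows "central_char b l = central_char b m"
proof -
  have "(l, m) \<in> ({(x, y). linked i x y} \<union> {(x, y). linked i y x})\<^sup>*"
    using assms(4) by (simp add: same_cell_block_idx_def same_cell_block_def)
  then show ?thesis
  proof (induction rule: rtrancl_induct)
    case (step y z)
    then show ?case using central_char_linked[OF assms(1,2) _ assms(3)] by auto
  qed simp
qed

lemma same_cell_refl: "l \<in> Li i \<Longrightarrow> same_cell i l l"
  by (simp add: same_cell_block_idx_def same_cell_block_def)

lemma same_cell_linked:
  assumes "linked i l m"
  shows "same_cell i l m" "same_cell i m l"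
proof -
  have "l \<in> Li i" "m \<in> Li i" using assms by (auto simp: cell_linked_def Lam0_def)
  then show "same_cell i l m" "same_cell i m l"
    using assms by (auto simp: same_cell_block_idx_def same_cell_block_def intro!: r_into_rtrancl)
qed

lemma same_cell_Lam: "same_cell i l m \<Longrightarrow> m \<in> Lam"
  using Li_D by (auto simp: same_cell_block_idx_def same_cell_block_def)

text \<open>The set reachable from \<open>l\<close> is closed under linkage, so some central
  idempotent \<open>b\<close> is 1 at \<open>l\<close> and 0 at \<open>m\<close>. Multiplying by
  \<open>b\<close> and \<open>1 - b\<close> would split the common block idempotent into two nonzero
  pieces.\<close>

lemma same_block_imp_chain:
  assumes L0: "Lam_0 = Lam" and l: "l \<in> Lam" and m: "m \<in> Lam"
    and blk: "same_block sc Lam le T c l m"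
  shows "(l, m) \<in> {(x, y). \<exists>i\<in>I. same_cell i x y}\<^sup>*"
proof (rule ccontr)
  assume notin: "(l, m) \<notin> {(x, y). \<exists>i\<in>I. same_cell i x y}\<^sup>*"
  define E where "E = {(x, y). \<exists>i\<in>I. same_cell i x y}"
  define S where "S = {n. (l, n) \<in> E\<^sup>*}"
  have "link_closed S"
    unfolding link_closed_def
  proof (intro ballI allI impI)
    fix i x y assume "i \<in> I" "linked i x y"
    then have "(x, y) \<in> E" "(y, x) \<in> E"
      unfolding E_def using same_cell_linked by blast+
    then show "x \<in> S \<longleftrightarrow> y \<in> S"
      unfolding S_def by (auto intro: rtrancl_into_rtrancl)
  qed
  from ex_splitting_idempotent[OF this L0] obtain b where b: "central b" "b * b = b"
    and central_char_b: "\<And>n. n \<in> Lam \<Longrightarrow> central_char b n = (if n \<in> S then 1 else 0)" by blast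
  have kl: "central_char b l = 1" and km: "central_char b m = 0"
    using central_char_b l m notin by (auto simp: S_def E_def)
  obtain p where p: "primitive_central_idem p" "in_block sc Lam le T c p l" "in_block sc Lam le T c p m"
    using blk by (auto simp: same_block_def)
  have pc: "central p" "p * p = p" using p(1) by (auto simp: primitive_central_idem_def)
  have pl: "central_char p l = 1" "central_char p m = 1" using p in_block_iff[OF _ pc(1)] l m L0 by auto
  have comm: "p * x = x * p" "b * x = x * b" for x using pc(1) b(1) unfolding central_def by blast+
  define d where "d = 1 - b"
  have "d * x = x * d" for x using comm(2)[of x] by (simp add: d_def left_diff_distrib right_diff_distrib)
  then have d: "central d" unfolding central_def by blast
  have bd: "d * d = d" "b * d = 0"
    using b(2) by (simp_all add: d_def left_diff_distrib right_diff_distrib)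
  have db: "b + d = 1" by (simp add: d_def)
  have kd: "central_char d m = 1" using central_char_add[of m b d] central_char_one[of m] db km m L0 b(1) d by simp
  have cen: "central (p * b)" "central (p * d)"
    using pc(1) b(1) d unfolding central_def by (metis mult.assoc)+
  have idem: "(p * b) * (p * b) = p * b" "(p * d) * (p * d) = p * d" "(p * b) * (p * d) = 0"
    using pc(2) b(2) bd comm(1) by (metis mult.assoc, metis mult.assoc, metis mult.assoc mult_zero_right)
  have "p = p * b + p * d" using db by (metis distrib_left mult.right_neutral)
  then have "p * b = 0 \<or> p * d = 0"
    using p(1) cen idem unfolding primitive_central_idem_def by blast
  moreover have "central_char (p * b) l = 1" "central_char (p * d) m = 1"
    using central_char_mult[of l p b] central_char_mult[of m p d] l m L0 pc(1) b(1) d pl kl kd by simp_all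
  ultimately show False using central_char_zero l m L0 by (metis zero_neq_one)
qed

end

theorem theorem5p1:
  fixes sc :: "'k::field \<Rightarrow> 'a::ring_1 \<Rightarrow> 'a"
    and Lam :: "'l set" and le :: "'l \<Rightarrow> 'l \<Rightarrow> bool"
    and T :: "'l \<Rightarrow> 't set" and c :: "'l \<Rightarrow> 't \<Rightarrow> 't \<Rightarrow> 'a"
    and star :: "'a \<Rightarrow> 'a" and I :: "'i set" and e :: "'i \<Rightarrow> 'a"
  assumes "cellular_algebra sc Lam le T c star"
    and "idempotent_decomp star Lam T c I e"
    and "Lam0 sc Lam le T c = Lam"
    and "l \<in> Lam" and "m \<in> Lam"
  shows "same_block sc Lam le T c l m \<longleftrightarrow>
    (\<exists>(r::nat) (nu::nat \<Rightarrow> 'l).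
       (\<forall>j\<le>r. nu j \<in> Lam) \<and>
       (\<exists>i\<in>I. same_cell_block_idx sc Lam le T c e i l (nu 0)) \<and>
       (\<forall>j<r. \<exists>i\<in>I. same_cell_block_idx sc Lam le T c e i (nu j) (nu (Suc j))) \<and>
       (\<exists>i\<in>I. same_cell_block_idx sc Lam le T c e i m (nu r)))"
proof -
  interpret cellular_decomp sc Lam le T c star I e
    using assms(1,2) by unfold_locales
  note L0 = assms(3) and l = assms(4) and m = assms(5)
  show ?thesis
  proof
    assume "same_block sc Lam le T c l m"
    from same_block_imp_chain[OF L0 l m this]
    obtain r where "(l, m) \<in> {(x, y). \<exists>i\<in>I. same_cell i x y} ^^ r" by (meson rtrancl_imp_relpow)
    then obtain nu where nu: "nu 0 = l" "nu r = m"
      "\<And>j. j < r \<Longrightarrow> \<exists>i\<in>I. same_cell i (nu j) (nu (Suc j))"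
      unfolding relpow_fun_conv by auto
    have "nu j \<in> Lam" if "j \<le> r" for j
    proof (cases j)
      case (Suc j')
      then show ?thesis using nu(3)[of j'] that same_cell_Lam by auto
    qed (use nu l in simp)
    \<comment> \<open>The chain obtained runs from \<open>l\<close> to \<open>m\<close> itself, so
      the two end conditions are reflexive instances in corners containing these labels.\<close>
    moreover have "\<exists>i\<in>I. same_cell i l (nu 0)" "\<exists>i\<in>I. same_cell i m (nu r)"
      using ex_Li[OF l] ex_Li[OF m] same_cell_refl nu by blast+
    ultimately show "\<exists>r nu. (\<forall>j\<le>r. nu j \<in> Lam) \<and> (\<exists>i\<in>I. same_cell i l (nu 0)) \<and>
       (\<forall>j<r. \<exists>i\<in>I. same_cell i (nu j) (nu (Suc j))) \<and> (\<exists>i\<in>I. same_cell i m (nu r))"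
      using nu(3) by blast
  next
    assume "\<exists>r nu. (\<forall>j\<le>r. nu j \<in> Lam) \<and> (\<exists>i\<in>I. same_cell i l (nu 0)) \<and>
       (\<forall>j<r. \<exists>i\<in>I. same_cell i (nu j) (nu (Suc j))) \<and> (\<exists>i\<in>I. same_cell i m (nu r))"
    then obtain r nu where nu: "\<exists>i\<in>I. same_cell i l (nu 0)"
      "\<forall>j<r. \<exists>i\<in>I. same_cell i (nu j) (nu (Suc j))" "\<exists>i\<in>I. same_cell i m (nu r)"
      by blast
    \<comment> \<open>The block idempotent of \<open>l\<close> has character 1 at \<open>l\<close>,
      and this value propagates along the chain to \<open>m\<close>.\<close>
    obtain b where b: "primitive_central_idem b" "central_char b l = 1" using ex_block[of l] l L0 by blast
    have bc: "central b" using b(1) by (simp add: primitive_central_idem_def)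
    note central_char = central_char_same_cell[OF _ L0 bc]
    have "central_char b (nu j) = 1" if "j \<le> r" for j
      using that
    proof (induction j)
      case 0
      show ?case using nu(1) central_char b(2) by metis
    next
      case (Suc j)
      then show ?case using nu(2) central_char by (metis Suc_le_lessD less_imp_le_nat)
    qed
    then have "central_char b m = 1" using nu(3) central_char by (metis order_refl)
    then show "same_block sc Lam le T c l m"
      unfolding same_block_def using b in_block_iff[OF _ bc] l m L0 by blast
  qed
qed

end
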